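(* Let $1 \le p \le \infty$ and $r \in \mathbb{N}^d$. Then there is a constant $C$ depending only on $r,d$ such that for every $d$-parallelepiped $Q=[a_1,b_1]\times\cdots\times[a_d,b_d]$ and every $f \in L_p(Q)$ $$\Big(\sum_{e \subset [d]}\prod_{i \in e} 2^{r_i}\Big)^{-1} \Omega_r(f,\delta)_{p,Q} \ \le \ E_r(f)_{p,Q} \ \le \ C\, \Omega_r(f,\delta)_{p,Q},$$ where $\delta = \delta(Q) := (b_1-a_1,\dots,b_d-a_d)$ is the size of $Q$.
   Context: $\mathbb{N}$ denotes the positive integers, $\mathbb{Z}_+$ and $\mathbb{R}_+$ the non-negative integers and non-negative reals, and $[d]=\{1,\dots,d\}$. $Q = [a_1,b_1]\times\cdots\times[a_d,b_d]\subset\mathbb{R}^d$ with $a_i<b_i$. $L_p(Q)$ is the usual space of Lebesgue measurable functions on $Q$ with norm $\|\cdot\|_{p,Q}$ (the ess sup norm if $p=\infty$); more generally $\|\cdot\|_{p,D}$ is the $L_p$ norm over a measurable set $D$. Sums over $e\subset[d]$ include $e=\emptyset$ unless excluded, and empty products equal $1$. For $r\in\mathbb{Z}_+^d$, $\mathcal{P}_r$ is the set of algebraic polynomials in $x=(x_1,\dots,x_d)$ of degree at most $r_i-1$ in the variable $x_i$, $i\in[d]$, and $$E_r(f)_{p,Q} := \inf_{\varphi\in\mathcal{P}_r}\|f-\varphi\|_{p,Q}.$$ For $m\in\mathbb{Z}_+$, $h\in\mathbb{R}$ and a univariate function $f$, $\Delta_h^m(f,x) := \sum_{j=0}^m(-1)^{m-j}\binom{m}{j}f(x+jh)$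 (with $\Delta_h^0 f=f$). For $r\in\mathbb{Z}_+^d$ and $h\in\mathbb{R}^d$, the mixed difference operator is $\Delta_h^r := \prod_{i=1}^d\Delta_{h_i,i}^{r_i}$, where $\Delta_{h_i,i}^{r_i}$ is the univariate operator $\Delta_{h_i}^{r_i}$ applied to $f$ as a function of $x_i$ with the other variables fixed. For $y,h\in\mathbb{R}^d$ put $yh:=(y_1h_1,\dots,y_dh_d)$ and $Q_y := \{x\in Q : x_i,\ x_i+y_i\in[a_i,b_i],\ i\in[d]\}$. The mixed $r$th modulus of smoothness is $$\omega_r(f,t)_{p,Q} := \sup_{|h_i|\le t_i,\ i\in[d]}\|\Delta_h^r(f)\|_{p,Q_{rh}},\qquad t\in\mathbb{R}_+^d.$$ For $r\in\mathbb{Z}_+^d$ and $e\subset[d]$, $r(e)\in\mathbb{Z}_+^d$ is the vector with $r(e)_i=r_i$ for $i\in e$ and $r(e)_i=0$ for $i\notin e$. The total mixed modulus of smoothness of order $r$ is $$\Omega_r(f,t)_{p,Q} := \sum_{e\subset[d],\ e\ne\emptyset}\omega_{r(e)}(f,t)_{p,Q},\qquad t\in\mathbb{R}_+^d.$$ *)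

theory Defs
  imports "HOL-Probability.Essential_Supremum"
begin

text \<open>
  The dimension $d$ is \<open>CARD('d)\<close> for a finite index type \<open>'d\<close>; points are of type \<open>real ^ 'd\<close>
  and multi-indices of type \<open>nat ^ 'd\<close>. Functions on a domain \<open>D\<close> are total functions whose
  values outside \<open>D\<close> are never used. Norms take values in \<open>ennreal\<close>, with \<open>p = \<infinity>\<close> allowed,
  so that infima and suprema of norms are unconditional.
\<close>

definition Lp_norm :: "ennreal \<Rightarrow> (real ^ 'd) set \<Rightarrow> (real ^ 'd \<Rightarrow> real) \<Rightarrow> ennreal" where
  "Lp_norm p D f =
     (if p = \<infinity> then esssup (lebesgue_on D) (\<lambda>x. ennreal \<bar>f x\<bar>)
      else let I = (\<integral>\<^sup>+ x. ennreal (\<bar>f x\<bar> powr enn2real p) \<partial>lebesgue_on D)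
           in if I = \<infinity> then \<infinity> else ennreal (enn2real I powr (1 / enn2real p)))"

definition Lp_space :: "ennreal \<Rightarrow> (real ^ 'd) set \<Rightarrow> (real ^ 'd \<Rightarrow> real) set" where
  "Lp_space p D = {f. f \<in> borel_measurable (lebesgue_on D) \<and> Lp_norm p D f < \<infinity>}"

text \<open>If \<open>r $ i = 0\<close> for some \<open>i\<close>, the index set of the sum is empty and only the zero
  polynomial remains, in accordance with degree at most \<open>-1\<close>.\<close>

definition poly_space :: "nat ^ 'd \<Rightarrow> (real ^ 'd \<Rightarrow> real) set" where
  "poly_space r =
     {\<phi>. \<exists>c :: nat ^ 'd \<Rightarrow> real.
           \<phi> = (\<lambda>x. \<Sum>k | \<forall>i. k $ i < r $ i. c k * (\<Prod>i\<in>UNIV. (x $ i) ^ (k $ i)))}"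

lemma finite_multi_indices: "finite {k :: nat ^ 'd. \<forall>i. k $ i < r $ i}"
proof -
  have "finite (PiE (UNIV :: 'd set) (\<lambda>i. {..< r $ i}))"
    by (intro finite_PiE) auto
  moreover have "{k :: nat ^ 'd. \<forall>i. k $ i < r $ i}
      \<subseteq> vec_lambda ` PiE UNIV (\<lambda>i. {..< r $ i})"
    by (force simp: image_iff PiE_iff intro!: bexI[where x = "vec_nth _"])
  ultimately show ?thesis
    by (meson finite_imageI finite_subset)
qed

definition best_approx :: "nat ^ 'd \<Rightarrow> (real ^ 'd \<Rightarrow> real) \<Rightarrow> ennreal \<Rightarrow> (real ^ 'd) set \<Rightarrow> ennreal" where
  "best_approx r f p Q = (INF \<phi>\<in>poly_space r. Lp_norm p Q (\<lambda>x. f x - \<phi> x))"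

definition fdiff :: "nat \<Rightarrow> real \<Rightarrow> (real \<Rightarrow> real) \<Rightarrow> real \<Rightarrow> real" where
  "fdiff m h f x = (\<Sum>j\<le>m. (-1) ^ (m - j) * real (m choose j) * f (x + real j * h))"

definition partial_fdiff :: "'d \<Rightarrow> nat \<Rightarrow> real \<Rightarrow> (real ^ 'd \<Rightarrow> real) \<Rightarrow> real ^ 'd \<Rightarrow> real" where
  "partial_fdiff i m h f x = fdiff m h (\<lambda>s. f (\<chi> k. if k = i then s else x $ k)) (x $ i)"

text \<open>The product of operators over \<open>i\<close> is their composition, taken in an arbitrary order;
  the lemma below shows that the fold is well defined.\<close>

definition mixed_diff :: "nat ^ 'd \<Rightarrow> real ^ 'd \<Rightarrow> (real ^ 'd \<Rightarrow> real) \<Rightarrow> real ^ 'd \<Rightarrow> real" where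
  "mixed_diff r h f = Finite_Set.fold (\<lambda>i. partial_fdiff i (r $ i) (h $ i)) f UNIV"

lemma comp_fun_commute_partial_fdiff:
  fixes r :: "nat ^ 'd" and h :: "real ^ 'd"
  shows "comp_fun_commute (\<lambda>i. partial_fdiff i (r $ i) (h $ i))"
proof (unfold_locales, rule ext, rule ext)
  fix i l :: 'd and f :: "real ^ 'd \<Rightarrow> real" and x
  show "(partial_fdiff i (r $ i) (h $ i) \<circ> partial_fdiff l (r $ l) (h $ l)) f x =
        (partial_fdiff l (r $ l) (h $ l) \<circ> partial_fdiff i (r $ i) (h $ i)) f x"
  proof (cases "i = l")
    case False
    have eq: "(\<chi> k. if k = l then (\<chi> k. if k = i then s else x $ k) $ l + t
                      else (\<chi> k. if k = i then s else x $ k) $ k) =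
              (\<chi> k. if k = i then s else if k = l then x $ l + t else x $ k)"
      and eq': "(\<chi> k. if k = i then (\<chi> k. if k = l then t else x $ k) $ i + s
                      else (\<chi> k. if k = l then t else x $ k) $ k) =
              (\<chi> k. if k = i then x $ i + s else if k = l then t else x $ k)" for s t
      using False by (auto simp: vec_eq_iff)
    show ?thesis
      unfolding partial_fdiff_def fdiff_def o_def eq eq' sum_distrib_left
      using False by (subst sum.swap) (simp add: mult_ac)
  qed simp
qed

definition shift_domain :: "(real ^ 'd) set \<Rightarrow> real ^ 'd \<Rightarrow> (real ^ 'd) set" where
  "shift_domain Q y = {x \<in> Q. x + y \<in> Q}"

definition mixed_modulus ::
    "nat ^ 'd \<Rightarrow> (real ^ 'd \<Rightarrow> real) \<Rightarrow> real ^ 'd \<Rightarrow> ennreal \<Rightarrow> (real ^ 'd) set \<Rightarrow> ennreal" where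
  "mixed_modulus r f t p Q =
     (SUP h\<in>{h. \<forall>i. \<bar>h $ i\<bar> \<le> t $ i}.
        Lp_norm p (shift_domain Q (\<chi> i. real (r $ i) * h $ i)) (mixed_diff r h f))"

definition restrict_index :: "nat ^ 'd \<Rightarrow> 'd set \<Rightarrow> nat ^ 'd" where
  "restrict_index r e = (\<chi> i. if i \<in> e then r $ i else 0)"

definition total_modulus ::
    "nat ^ 'd \<Rightarrow> (real ^ 'd \<Rightarrow> real) \<Rightarrow> real ^ 'd \<Rightarrow> ennreal \<Rightarrow> (real ^ 'd) set \<Rightarrow> ennreal" where
  "total_modulus r f t p Q = (\<Sum>e | e \<noteq> {}. mixed_modulus (restrict_index r e) f t p Q)"

end

theory Submission
  imports Defs "HOL-Probability.Probability_Measure"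
begin

text \<open>
  The lower bound is elementary. A mixed difference over a nonempty set of directions \<open>e\<close> annihilates
  the polynomial space, and it is a combination of translates whose coefficients have absolute sum
  \<open>\<Prod>i\<in>e. 2 ^ (r $ i)\<close>. So its norm is at most this number times the norm of \<open>f - \<phi>\<close> for every
  admissible polynomial \<open>\<phi>\<close> (\<open>total_modulus_le_best_approx\<close>).

  For the upper bound the moduli in the single coordinate directions suffice. Suppose that for each
  direction \<open>i\<close> there is a linear operator \<open>P\<^sub>i\<close>, bounded on \<open>L\<^sub>p\<close>, whose values are polynomials of
  degree less than \<open>r $ i\<close> in the \<open>i\<close>-th variable and which satisfies Whitney's inequality
  \<open>\<parallel>f - P\<^sub>i f\<parallel> \<le> C W\<close>, where \<open>W\<close> bounds the differences of order \<open>r $ i\<close> in direction \<open>i\<close>. Applying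
  these operators one after another produces a polynomial in all variables, and the telescoping
  identity \<open>f - P g = (f - P f) + P (f - g)\<close> adds up the errors (\<open>Whitney_coordinates\<close>).

  The operator in one direction is interpolation of means. Every edge of the box is divided into
  \<open>M\<close> equal cells, and \<open>P f\<close> is the polynomial of degree less than \<open>r\<close> with the same integrals as
  \<open>f\<close> over the first \<open>r\<close> cells. The error \<open>u = f - P f\<close> is estimated on an edge as follows
  (\<open>pointwise_bound\<close>). Averaging the \<open>r\<close>-th difference of \<open>u\<close> at \<open>t\<close> over its step expresses \<open>u t\<close>
  by this average and by the primitive of \<open>u\<close> at a few points. The primitive is a sum of integrals
  over cells and of one integral over an interval shorter than a cell. The integrals over the
  first \<open>r\<close> cells are \<open>0\<close>, and the others follow from them by a linear recurrence whose
  inhomogeneous terms are integrals of \<open>r\<close>-th differences. What remains are integrals of \<open>\<bar>u\<bar>\<close> over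
  intervals of length \<open>1/M\<close>. Their norms are at most \<open>\<parallel>u\<parallel> / M\<close>, with a coefficient that depends on
  \<open>r\<close> only, so for large \<open>M\<close> they are absorbed on the left (\<open>Lp_le_dir_proj_error\<close>).

  Differences of \<open>u\<close> and of \<open>f\<close> coincide, as \<open>P f\<close> is a polynomial on every edge. All norm estimates
  are Minkowski's integral inequality for averages of translates (\<open>Lp_le_integral\<close>,
  \<open>Lp_le_translate\<close>), hence the constants do not depend on \<open>p\<close>, on the box or on \<open>f\<close>.
\<close>

section \<open>Norm bounds and Minkowski's inequality\<close>

text \<open>
  The extended-real norm over a subdomain is awkward in estimates. For a Borel function on the
  whole space the statement that its \<open>L\<^sub>p\<close> norm is at most a real number \<open>B\<close> avoids roots, treats
  \<open>p = \<infinity>\<close> in parallel, and makes translation invariance meaningful; a domain enters by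
  multiplication with its indicator function.
\<close>

definition Lp_le :: "ennreal \<Rightarrow> (real ^ 'd \<Rightarrow> real) \<Rightarrow> real \<Rightarrow> bool" where
  "Lp_le p f B \<longleftrightarrow> f \<in> borel_measurable borel \<and> 0 \<le> B \<and>
     (if p = \<infinity> then AE x in lborel. \<bar>f x\<bar> \<le> B
      else (\<integral>\<^sup>+x. ennreal (\<bar>f x\<bar> powr enn2real p) \<partial>lborel) \<le> ennreal (B powr enn2real p))"

lemma Lp_le_measurable: "Lp_le p f B \<Longrightarrow> f \<in> borel_measurable borel"
  and Lp_le_nonneg: "Lp_le p f B \<Longrightarrow> 0 \<le> B"
  by (auto simp: Lp_le_def)

lemma enn2real_ge_1:
  assumes "1 \<le> p" "p \<noteq> \<infinity>" shows "1 \<le> enn2real p"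
  by (metis assms enn2real_1 enn2real_mono ennreal_top_neq_one infinity_ennreal_def
      top.not_eq_extremum)

lemma Bernoulli_powr:
  fixes q t :: real assumes "1 \<le> q" "0 \<le> t" shows "1 + q * (t - 1) \<le> t powr q"
proof (cases "t = 0")
  case False
  then have t: "t > 0" using assms by simp
  have "1 + q * (t - 1) \<le> t powr q"
  proof -
    have "((\<lambda>x. x powr q) has_real_derivative q * 1 powr (q - 1)) (at 1 within {0<..})"
      by (rule derivative_eq_intros refl | simp)+
    from convex_on_imp_above_tangent[OF powr_convex[OF assms(1)] _ _ _ this, of t] t
    show ?thesis by (auto simp: algebra_simps interior_open)
  qed
  then show ?thesis .
qed (use assms in auto)

text \<open>
  Bernoulli's inequality at the mean value gives a supporting line for the \<open>q\<close>-th power, which is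
  then integrated. A non-integrable function has Bochner integral \<open>0\<close>, which makes its case trivial.
\<close>

lemma Jensen_powr:
  fixes X :: "'a \<Rightarrow> real"
  assumes "prob_space \<nu>" and [measurable]: "X \<in> borel_measurable \<nu>" and nn: "\<And>\<theta>. 0 \<le> X \<theta>" and q: "1 \<le> q"
  shows "ennreal ((\<integral>\<theta>. X \<theta> \<partial>\<nu>) powr q) \<le> (\<integral>\<^sup>+\<theta>. ennreal (X \<theta> powr q) \<partial>\<nu>)"
proof -
  interpret prob_space \<nu> by fact
  define m where "m = (\<integral>\<theta>. X \<theta> \<partial>\<nu>)"
  have m0: "0 \<le> m" unfolding m_def using nn by simp
  show ?thesis
  proof (cases "m = 0 \<or> (\<integral>\<^sup>+\<theta>. ennreal (X \<theta> powr q) \<partial>\<nu>) = \<infinity>")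
    case True then show ?thesis unfolding m_def[symmetric] using q by auto
  next
    case False
    then have m: "m > 0" using m0 by simp
    have iX: "integrable \<nu> X"
      using False not_integrable_integral_eq unfolding m_def by blast
    have iXq: "integrable \<nu> (\<lambda>\<theta>. X \<theta> powr q)"
      using False by (intro integrableI_nonneg) (auto simp: top.not_eq_extremum)
    have "m powr q = (\<integral>\<theta>. m powr q * (1 + q * (X \<theta> / m - 1)) \<partial>\<nu>)"
      using iX m by (simp add: m_def[symmetric] prob_space)
    also have "\<dots> \<le> (\<integral>\<theta>. X \<theta> powr q \<partial>\<nu>)"
    proof (intro integral_mono iXq)
      show "integrable \<nu> (\<lambda>\<theta>. m powr q * (1 + q * (X \<theta> / m - 1)))" using iX by simp
      fix \<theta>
      have "m powr q * (1 + q * (X \<theta> / m - 1)) \<le> m powr q * (X \<theta> / m) powr q"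
        by (intro mult_left_mono Bernoulli_powr q) (use nn m in auto)
      also have "\<dots> = X \<theta> powr q" using m nn by (simp add: powr_mult[symmetric])
      finally show "m powr q * (1 + q * (X \<theta> / m - 1)) \<le> X \<theta> powr q" .
    qed
    finally have "ennreal (m powr q) \<le> ennreal (\<integral>\<theta>. X \<theta> powr q \<partial>\<nu>)" by (rule ennreal_leI)
    also have "\<dots> = (\<integral>\<^sup>+\<theta>. ennreal (X \<theta> powr q) \<partial>\<nu>)"
      by (rule nn_integral_eq_integral[symmetric, OF iXq]) auto
    finally show ?thesis unfolding m_def .
  qed
qed

text \<open>
  Minkowski's integral inequality for a probability measure. This is the only source of norm
  estimates below: sums of functions, averages of translates and directional integrals are all
  instances, and the constant \<open>1\<close> is why the final constant does not depend on \<open>p\<close>.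
\<close>

lemma Lp_le_integral:
  fixes F :: "'a \<Rightarrow> real ^ 'd \<Rightarrow> real"
  assumes pr: "prob_space \<nu>" and p: "1 \<le> p"
    and F[measurable]: "(\<lambda>(\<theta>, x). F \<theta> x) \<in> borel_measurable (\<nu> \<Otimes>\<^sub>M borel)"
    and le: "\<And>\<theta>. \<theta> \<in> space \<nu> \<Longrightarrow> Lp_le p (F \<theta>) B"
  shows "Lp_le p (\<lambda>x. \<integral>\<theta>. \<bar>F \<theta> x\<bar> \<partial>\<nu>) B"
proof -
  interpret prob_space \<nu> by fact
  interpret P: pair_sigma_finite \<nu> "lborel :: (real ^ 'd) measure" ..
  have F2[measurable]: "(\<lambda>(\<theta>, x). F \<theta> x) \<in> borel_measurable (\<nu> \<Otimes>\<^sub>M lborel)"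
    using F by (simp cong: measurable_cong_sets sets_pair_measure_cong)
  have F3[measurable]: "(\<lambda>(x, \<theta>). F \<theta> x) \<in> borel_measurable (lborel \<Otimes>\<^sub>M \<nu>)"
    using measurable_pair_swap[OF F2] by (simp add: case_prod_beta)
  have pred: "Measurable.pred (\<nu> \<Otimes>\<^sub>M lborel) (\<lambda>x. \<bar>F (fst x) (snd x)\<bar> \<le> B)"
    using F2 by (simp only: case_prod_beta') measurable
  have Fs[measurable]: "(\<lambda>\<theta>. F \<theta> x) \<in> borel_measurable \<nu>" for x :: "real ^ 'd"
    using measurable_compose[OF measurable_Pair2'[of x lborel] F2] by simp
  from not_empty obtain \<theta>0 where "\<theta>0 \<in> space \<nu>" by blast
  then have B: "0 \<le> B" using Lp_le_nonneg[OF le] by blast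
  have m: "(\<lambda>x. \<integral>\<theta>. \<bar>F \<theta> x\<bar> \<partial>\<nu>) \<in> borel_measurable lborel"
    by measurable
  show ?thesis
  proof (cases "p = \<infinity>")
    case True
    have "AE \<theta> in \<nu>. AE x in lborel. \<bar>F \<theta> x\<bar> \<le> B"
      using le True by (auto simp: Lp_le_def intro: AE_I2)
    then have "AE x in lborel. AE \<theta> in \<nu>. \<bar>F \<theta> x\<bar> \<le> B"
      using pred by (subst P.AE_commute[symmetric]) (simp_all add: pred_def)
    then have "AE x in lborel. \<bar>\<integral>\<theta>. \<bar>F \<theta> x\<bar> \<partial>\<nu>\<bar> \<le> B"
    proof eventually_elim
      case (elim x)
      have i: "integrable \<nu> (\<lambda>\<theta>. F \<theta> x)"
        by (rule integrable_const_bound[of _ B]) (use elim in auto)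
      have "(\<integral>\<theta>. \<bar>F \<theta> x\<bar> \<partial>\<nu>) \<le> (\<integral>\<theta>. B \<partial>\<nu>)"
        by (intro integral_mono_AE) (use i elim in auto)
      then show ?case by (simp add: prob_space)
    qed
    then show ?thesis using m B True by (simp add: Lp_le_def)
  next
    case False
    define q where "q = enn2real p"
    have q: "1 \<le> q" unfolding q_def using enn2real_ge_1[OF p False] .
    have "(\<integral>\<^sup>+x. ennreal (\<bar>\<integral>\<theta>. \<bar>F \<theta> x\<bar> \<partial>\<nu>\<bar> powr q) \<partial>lborel)
        \<le> (\<integral>\<^sup>+x. (\<integral>\<^sup>+\<theta>. ennreal (\<bar>F \<theta> x\<bar> powr q) \<partial>\<nu>) \<partial>lborel)"
    proof (intro nn_integral_mono)
      fix x
      show "ennreal (\<bar>\<integral>\<theta>. \<bar>F \<theta> x\<bar> \<partial>\<nu>\<bar> powr q) \<le> (\<integral>\<^sup>+\<theta>. ennreal (\<bar>F \<theta> x\<bar> powr q) \<partial>\<nu>)"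
        using Jensen_powr[OF pr _ _ q, of "\<lambda>\<theta>. \<bar>F \<theta> x\<bar>"] by simp
    qed
    also have "\<dots> = (\<integral>\<^sup>+\<theta>. (\<integral>\<^sup>+x. ennreal (\<bar>F \<theta> x\<bar> powr q) \<partial>lborel) \<partial>\<nu>)"
      by (rule P.Fubini') measurable
    also have "\<dots> \<le> (\<integral>\<^sup>+\<theta>. ennreal (B powr q) \<partial>\<nu>)"
      using le False by (intro nn_integral_mono) (simp add: Lp_le_def q_def)
    also have "\<dots> = ennreal (B powr q)" by (simp add: emeasure_space_1)
    finally show ?thesis using m B False by (simp add: Lp_le_def q_def)
  qed
qed

lemma Lp_le_AE_mono:
  assumes g: "Lp_le p g B" and f: "f \<in> borel_measurable borel" and le: "AE x in lborel. \<bar>f x\<bar> \<le> \<bar>g x\<bar>" and "B \<le> C"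
  shows "Lp_le p f C"
proof -
  have B: "0 \<le> B" using Lp_le_nonneg[OF g] .
  show ?thesis
  proof (cases "p = \<infinity>")
    case True
    have "AE x in lborel. \<bar>g x\<bar> \<le> B" using g True by (simp add: Lp_le_def)
    with le have "AE x in lborel. \<bar>f x\<bar> \<le> C" by eventually_elim (use \<open>B \<le> C\<close> in linarith)
    then show ?thesis using B f True \<open>B \<le> C\<close> by (simp add: Lp_le_def)
  next
    case False
    have "(\<integral>\<^sup>+x. ennreal (\<bar>f x\<bar> powr enn2real p) \<partial>lborel) \<le> (\<integral>\<^sup>+x. ennreal (\<bar>g x\<bar> powr enn2real p) \<partial>lborel)"
      by (rule nn_integral_mono_AE) (use le in \<open>eventually_elim, auto intro!: ennreal_leI powr_mono2\<close>)
    also have "\<dots> \<le> ennreal (B powr enn2real p)" using g False by (simp add: Lp_le_def)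
    also have "\<dots> \<le> ennreal (C powr enn2real p)"
      using B \<open>B \<le> C\<close> by (intro ennreal_leI powr_mono2) auto
    finally show ?thesis using B f False \<open>B \<le> C\<close> by (simp add: Lp_le_def)
  qed
qed

lemma Lp_le_mono:
  assumes "Lp_le p g B" "f \<in> borel_measurable borel" "\<And>x. \<bar>f x\<bar> \<le> \<bar>g x\<bar>" "B \<le> C"
  shows "Lp_le p f C"
  using Lp_le_AE_mono[OF assms(1,2) _ assms(4)] assms(3) by simp

lemma Lp_le_cmult:
  assumes "Lp_le p f B" shows "Lp_le p (\<lambda>x. c * f x) (\<bar>c\<bar> * B)"
proof (cases "p = \<infinity>")
  case True
  then show ?thesis using assms
    by (auto simp: Lp_le_def abs_mult elim!: eventually_mono intro!: mult_left_mono)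
next
  case False
  have [measurable]: "f \<in> borel_measurable borel" and B: "0 \<le> B" using assms by (auto simp: Lp_le_def)
  have "(\<integral>\<^sup>+x. ennreal (\<bar>c * f x\<bar> powr enn2real p) \<partial>lborel)
      = ennreal (\<bar>c\<bar> powr enn2real p) * (\<integral>\<^sup>+x. ennreal (\<bar>f x\<bar> powr enn2real p) \<partial>lborel)"
    by (subst nn_integral_cmult[symmetric])
       (auto simp: abs_mult powr_mult ennreal_mult intro!: nn_integral_cong)
  also have "\<dots> \<le> ennreal (\<bar>c\<bar> powr enn2real p) * ennreal (B powr enn2real p)"
    using assms False by (intro mult_left_mono) (auto simp: Lp_le_def)
  also have "\<dots> = ennreal ((\<bar>c\<bar> * B) powr enn2real p)"
    using B by (simp add: powr_mult ennreal_mult)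
  finally show ?thesis using B False by (simp add: Lp_le_def)
qed

lemma Lp_le_0_iff:
  assumes "1 \<le> p" shows "Lp_le p f 0 \<longleftrightarrow> f \<in> borel_measurable borel \<and> (AE x in lborel. f x = 0)"
proof (cases "p = \<infinity>")
  case False
  then show ?thesis using enn2real_ge_1[OF assms False]
    by (auto simp: Lp_le_def nn_integral_0_iff_AE)
qed (simp add: Lp_le_def)

lemma Lp_le_zero: "1 \<le> p \<Longrightarrow> 0 \<le> B \<Longrightarrow> Lp_le p (\<lambda>x. 0) B"
  by (rule Lp_le_mono[of p "\<lambda>x. 0" 0]) (auto simp: Lp_le_0_iff)

text \<open>
  The triangle inequality is Minkowski's integral inequality for the probability measure on two
  points with masses \<open>A / (A + B)\<close> and \<open>B / (A + B)\<close>: after division by these masses both functions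
  have the same bound \<open>A + B\<close>.
\<close>

lemma Lp_le_add:
  assumes p: "1 \<le> p" and f: "Lp_le p f A" and g: "Lp_le p g B"
  shows "Lp_le p (\<lambda>x. \<bar>f x\<bar> + \<bar>g x\<bar>) (A + B)"
proof -
  have A: "0 \<le> A" and B: "0 \<le> B" and [measurable]: "f \<in> borel_measurable borel" "g \<in> borel_measurable borel"
    using f g by (auto simp: Lp_le_def)
  consider "A = 0" | "B = 0" | "A > 0" "B > 0" using A B by linarith
  then show ?thesis
  proof cases
    case 1
    then have "AE x in lborel. f x = 0" using f p by (simp add: Lp_le_0_iff)
    then show ?thesis using 1 by (intro Lp_le_AE_mono[OF g]) auto
  next
    case 2
    then have "AE x in lborel. g x = 0" using g p by (simp add: Lp_le_0_iff)
    then show ?thesis using 2 by (intro Lp_le_AE_mono[OF f]) auto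
  next
    case 3
    define \<nu> where "\<nu> = point_measure (UNIV :: bool set) (\<lambda>b. ennreal (if b then A / (A + B) else B / (A + B)))"
    have e1: "ennreal (A / (A + B)) + ennreal (B / (A + B)) = 1"
      using 3 by (subst ennreal_plus[symmetric]) (auto simp: add_divide_distrib[symmetric])
    have pr: "prob_space \<nu>"
      by (rule prob_spaceI)
         (simp add: \<nu>_def emeasure_point_measure_finite UNIV_bool e1 space_point_measure add.commute)
    define F where "F = (\<lambda>b x. if b then (A + B) / A * f x else (A + B) / B * g x)"
    have "Lp_le p (\<lambda>x. \<integral>b. \<bar>F b x\<bar> \<partial>\<nu>) (A + B)"
    proof (rule Lp_le_integral[OF pr p])
      have "(\<lambda>(b, x). F b x) \<in> borel_measurable (count_space UNIV \<Otimes>\<^sub>M borel)"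
        unfolding F_def by measurable
      then show "(\<lambda>(b, x). F b x) \<in> borel_measurable (\<nu> \<Otimes>\<^sub>M borel)"
        by (simp add: \<nu>_def cong: measurable_cong_sets sets_pair_measure_cong)
      fix b
      show "Lp_le p (F b) (A + B)"
        using Lp_le_cmult[OF f, of "(A + B) / A"] Lp_le_cmult[OF g, of "(A + B) / B"] 3
        by (cases b) (auto simp: F_def)
    qed
    moreover have "(\<integral>b. \<bar>F b x\<bar> \<partial>\<nu>) = \<bar>f x\<bar> + \<bar>g x\<bar>" for x
      using 3 unfolding \<nu>_def
      by (subst lebesgue_integral_point_measure_finite) (auto simp: UNIV_bool F_def abs_mult)
    ultimately show ?thesis by simp
  qed
qed

lemma Lp_le_sum:
  assumes p: "1 \<le> p" and "finite K" and "\<And>k. k \<in> K \<Longrightarrow> Lp_le p (f k) (A k)"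
  shows "Lp_le p (\<lambda>x. \<Sum>k\<in>K. \<bar>f k x\<bar>) (\<Sum>k\<in>K. A k)"
  using assms(2,3)
proof (induction K)
  case empty show ?case using Lp_le_zero[OF p, of 0] by simp
next
  case (insert k K)
  have "Lp_le p (\<lambda>x. \<bar>f k x\<bar> + \<bar>\<Sum>k\<in>K. \<bar>f k x\<bar>\<bar>) (A k + (\<Sum>k\<in>K. A k))"
    using insert by (intro Lp_le_add[OF p]) auto
  then show ?case using insert by simp
qed

lemma Lp_le_translate:
  assumes f: "Lp_le p f B" shows "Lp_le p (\<lambda>x. f (x + v)) B"
proof -
  have [measurable]: "f \<in> borel_measurable borel" using f by (simp add: Lp_le_def)
  have d: "lborel = distr lborel borel (\<lambda>x. x + v)"
    using lborel_distr_plus[of v] by (simp add: add.commute[of _ v])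
  show ?thesis
  proof (cases "p = \<infinity>")
    case True
    have "AE x in lborel. \<bar>f x\<bar> \<le> B" using True f by (simp add: Lp_le_def)
    then have "AE x in lborel. \<bar>f (x + v)\<bar> \<le> B"
      by (subst (asm) d, subst (asm) AE_distr_iff) auto
    then show ?thesis using f True by (simp add: Lp_le_def)
  next
    case False
    have "(\<integral>\<^sup>+x. ennreal (\<bar>f x\<bar> powr enn2real p) \<partial>lborel) = (\<integral>\<^sup>+x. ennreal (\<bar>f (x + v)\<bar> powr enn2real p) \<partial>lborel)"
      by (subst d, subst nn_integral_distr) auto
    then show ?thesis using f False by (simp add: Lp_le_def)
  qed
qed

lemma AE_lborel_translate:
  fixes v :: "'a::euclidean_space"
  assumes "AE x in lborel. P x" shows "AE x in lborel. P (x + v)"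
proof -
  obtain N where N: "N \<in> null_sets lborel" "{x. \<not> P x} \<subseteq> N" using assms by (auto elim: AE_E simp: null_sets_def)
  have d: "lborel = distr lborel borel (\<lambda>x. x + v)"
    using lborel_distr_plus[of v] by (simp add: add.commute[of _ v])
  have "AE x in lborel. x \<notin> N" using N by (simp add: AE_not_in)
  then have "AE x in lborel. x + v \<notin> N"
    by (subst (asm) d, subst (asm) AE_distr_iff) (use N in auto)
  then show ?thesis by eventually_elim (use N in auto)
qed

text \<open>
  The bridge between the norm over Lebesgue measure restricted to \<open>D\<close> and the Borel calculus.
  The function on the left may be any representative, even a non-Borel one; completeness of
  Lebesgue measure provides its measurability.
\<close>

lemma Lp_norm_le_iff:
  fixes f g :: "real ^ 'd \<Rightarrow> real"
  assumes p: "1 \<le> p" and D: "D \<in> sets borel" and [measurable]: "g \<in> borel_measurable borel"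
    and eq: "AE x in lborel. x \<in> D \<longrightarrow> f x = g x" and B: "0 \<le> B"
  shows "Lp_norm p D f \<le> ennreal B \<longleftrightarrow> Lp_le p (\<lambda>x. indicator D x * g x) B"
proof -
  note [measurable] = D
  have D': "D \<inter> space lebesgue \<in> sets lebesgue" using D by simp
  have eqD: "AE x in lebesgue_on D. g x = f x"
    using AE_completion[OF eq] by (subst AE_restrict_space_iff[OF D']) (auto elim!: eventually_mono)
  have mg: "g \<in> borel_measurable (lebesgue_on D)"
    using measurable_restrict_space1[OF measurable_completion[of g lborel borel]] by simp
  have mf: "f \<in> borel_measurable (lebesgue_on D)"
  proof -
    have "(\<lambda>x. if x \<in> D then g x else 0) \<in> borel_measurable lebesgue"
      by (intro measurable_completion) measurable
    moreover have "AE x in lebesgue. (if x \<in> D then g x else 0) = (if x \<in> D then f x else 0)"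
      using AE_completion[OF eq] by (auto elim!: eventually_mono)
    ultimately have "(\<lambda>x. if x \<in> D then f x else 0) \<in> borel_measurable lebesgue"
      by (rule borel_measurable_AE)
    then show ?thesis using D by (subst (asm) borel_measurable_if) auto
  qed
  show ?thesis
  proof (cases "p = \<infinity>")
    case True
    have "esssup (lebesgue_on D) (\<lambda>x. ennreal \<bar>f x\<bar>) \<le> ennreal B \<longleftrightarrow> (AE x in lebesgue_on D. ennreal \<bar>f x\<bar> \<le> ennreal B)"
      using esssup_AE[of "\<lambda>x. ennreal \<bar>f x\<bar>" "lebesgue_on D"] mf
      by (auto intro!: esssup_I elim!: eventually_mono)
    also have "\<dots> \<longleftrightarrow> (AE x in lebesgue_on D. \<bar>g x\<bar> \<le> B)"
    proof
      assume "AE x in lebesgue_on D. ennreal \<bar>f x\<bar> \<le> ennreal B"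
      with eqD show "AE x in lebesgue_on D. \<bar>g x\<bar> \<le> B" by eventually_elim (use B in simp)
    next
      assume "AE x in lebesgue_on D. \<bar>g x\<bar> \<le> B"
      with eqD show "AE x in lebesgue_on D. ennreal \<bar>f x\<bar> \<le> ennreal B" by eventually_elim (use B in simp)
    qed
    also have "\<dots> \<longleftrightarrow> (AE x in lborel. x \<in> D \<longrightarrow> \<bar>g x\<bar> \<le> B)"
      by (subst AE_restrict_space_iff[OF D']) (auto simp: AE_completion_iff)
    also have "\<dots> \<longleftrightarrow> (AE x in lborel. \<bar>indicator D x * g x\<bar> \<le> B)"
      using B by (intro iffI; elim eventually_mono) (auto simp: indicator_def split: if_splits)
    finally show ?thesis using True B by (simp add: Lp_norm_def Lp_le_def)
  next
    case False
    define q where "q = enn2real p"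
    have q: "1 \<le> q" unfolding q_def using enn2real_ge_1[OF p False] .
    define I where "I = (\<integral>\<^sup>+ x. ennreal (\<bar>f x\<bar> powr q) \<partial>lebesgue_on D)"
    have "I = (\<integral>\<^sup>+ x. ennreal (\<bar>g x\<bar> powr q) \<partial>lebesgue_on D)"
      unfolding I_def by (rule nn_integral_cong_AE) (use eqD in \<open>eventually_elim, simp\<close>)
    also have "\<dots> = (\<integral>\<^sup>+ x. ennreal (\<bar>g x\<bar> powr q) * indicator D x \<partial>lebesgue)"
      by (rule nn_integral_restrict_space[OF D'])
    also have "\<dots> = (\<integral>\<^sup>+ x. ennreal (\<bar>indicator D x * g x\<bar> powr q) \<partial>lborel)"
      unfolding nn_integral_completion using q
      by (intro nn_integral_cong) (auto simp: indicator_def)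
    finally have I: "I = (\<integral>\<^sup>+ x. ennreal (\<bar>indicator D x * g x\<bar> powr q) \<partial>lborel)" .
    have "Lp_norm p D f \<le> ennreal B \<longleftrightarrow> I \<le> ennreal (B powr q)"
    proof (cases I)
      case (real i)
      have "i powr (1 / q) \<le> B \<longleftrightarrow> i \<le> B powr q"
      proof
        assume "i powr (1/q) \<le> B"
        from powr_mono2[OF _ _ this, of q] show "i \<le> B powr q" using q real by (simp add: powr_powr)
      next
        assume "i \<le> B powr q"
        from powr_mono2[OF _ _ this, of "1/q"] show "i powr (1/q) \<le> B" using q real B by (simp add: powr_powr)
      qed
      then show ?thesis using False real B
        by (simp add: Lp_norm_def q_def[symmetric] I_def[symmetric])
    next
      case top
      then show ?thesis using False
        by (simp add: Lp_norm_def q_def[symmetric] I_def[symmetric] top_unique)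
    qed
    then show ?thesis using I B False by (simp add: Lp_le_def q_def)
  qed
qed

section \<open>Univariate differences and polynomials\<close>

lemma sum_binomials: "(\<Sum>j\<le>m. real (m choose j)) = 2 ^ m"
  using choose_row_sum[of m] by (metis of_nat_sum of_nat_power of_nat_numeral)

lemma fdiff_0 [simp]: "fdiff 0 h f = f"
  by (simp add: fdiff_def fun_eq_iff)

lemma fdiff_Suc: "fdiff (Suc m) h f x = fdiff m h f (x + h) - fdiff m h f x"
proof -
  define g where "g = (\<lambda>j::nat. f (x + real j * h))"
  have "fdiff (Suc m) h f x = (-1) ^ Suc m * g 0
      + (\<Sum>j\<le>m. (-1) ^ (m - j) * real (Suc m choose Suc j) * g (Suc j))"
    unfolding fdiff_def g_def[symmetric] by (subst sum.atMost_Suc_shift) (simp add: g_def)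
  also have "(\<Sum>j\<le>m. (-1) ^ (m - j) * real (Suc m choose Suc j) * g (Suc j))
      = (\<Sum>j\<le>m. (-1) ^ (m - j) * real (m choose j) * g (Suc j))
        + (\<Sum>j\<le>m. (-1) ^ (m - j) * real (m choose Suc j) * g (Suc j))"
    by (simp add: algebra_simps sum.distrib)
  also have "(\<Sum>j\<le>m. (-1) ^ (m - j) * real (m choose j) * g (Suc j)) = fdiff m h f (x + h)"
    unfolding fdiff_def g_def by (simp add: algebra_simps)
  also have "(\<Sum>j\<le>m. (-1) ^ (m - j) * real (m choose Suc j) * g (Suc j))
      = (\<Sum>j\<le>Suc m. (-1) ^ (Suc m - j) * real (m choose j) * g j) - (-1) ^ Suc m * g 0"
    by (subst sum.atMost_Suc_shift) simp
  also have "(\<Sum>j\<le>Suc m. (-1) ^ (Suc m - j) * real (m choose j) * g j)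
      = (\<Sum>j\<le>m. (-1) ^ (Suc m - j) * real (m choose j) * g j)" by simp
  also have "\<dots> = (\<Sum>j\<le>m. - ((-1) ^ (m - j) * real (m choose j) * g j))"
    by (intro sum.cong refl) (simp add: Suc_diff_le)
  also have "\<dots> = - fdiff m h f x" by (simp add: fdiff_def g_def sum_negf)
  finally show ?thesis by simp
qed

lemma fdiff_diff: "fdiff m h (\<lambda>y. f y - g y) x = fdiff m h f x - fdiff m h g x"
  by (simp add: fdiff_def algebra_simps sum_subtractf)

lemma fdiff_translate: "fdiff m h (\<lambda>y. f (y + c)) x = fdiff m h f (x + c)"
  by (simp add: fdiff_def add_ac)

lemma fdiff_cong:
  assumes "\<And>j. j \<le> m \<Longrightarrow> f (x + real j * h) = g (x + real j * h)" shows "fdiff m h f x = fdiff m h g x"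
  unfolding fdiff_def using assms by (intro sum.cong) auto

lemma degree_pcompose_shift_diff:
  fixes q :: "real poly"
  assumes "0 < degree q" shows "degree (pcompose q [:h, 1:] - q) < degree q"
proof (rule degree_lessI)
  show "\<forall>k\<ge>degree q. coeff (pcompose q [:h, 1:] - q) k = 0"
  proof safe
    fix k assume k: "degree q \<le> k"
    have d: "degree (pcompose q [:h, 1:]) = degree q" by (simp add: degree_pcompose)
    have "coeff (pcompose q [:h, 1:]) (degree q) = coeff q (degree q)"
      using lead_coeff_comp[of "[:h, 1:]" q] d by simp
    then show "coeff (pcompose q [:h, 1:] - q) k = 0"
      using k d by (cases "k = degree q") (auto simp: coeff_eq_0)
  qed
qed (use assms in simp)

text \<open>
  Each first difference lowers the degree of a polynomial, so \<open>m\<close> of them annihilate degree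
  less than \<open>m\<close>.
\<close>

lemma fdiff_poly_eq_0:
  assumes "degree q < m" shows "fdiff m h (poly q) x = 0"
  using assms
proof (induction m arbitrary: q x)
  case (Suc m)
  define q' where "q' = pcompose q [:h, 1:] - q"
  have "fdiff (Suc m) h (poly q) x = fdiff m h (\<lambda>y. poly q (y + h) - poly q y) x"
    by (simp add: fdiff_Suc fdiff_diff fdiff_translate)
  also have "(\<lambda>y. poly q (y + h) - poly q y) = poly q'"
    by (simp add: q'_def poly_pcompose fun_eq_iff add.commute)
  finally have eq: "fdiff (Suc m) h (poly q) x = fdiff m h (poly q') x" .
  show ?case
  proof (cases "degree q = 0")
    case True
    then have "q' = 0" by (auto simp: q'_def elim!: degree_eq_zeroE)
    then show ?thesis unfolding eq by (simp add: fdiff_def)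
  next
    case False
    then have "degree q' < m" using degree_pcompose_shift_diff[of q h] Suc.prems by (simp add: q'_def)
    then show ?thesis using Suc.IH eq by simp
  qed
qed simp

section \<open>Interpolation of cell integrals\<close>

text \<open>
  Cells are half-open so that an initial segment is exactly the disjoint union of cells.
\<close>

definition cell :: "nat \<Rightarrow> nat \<Rightarrow> real set" where
  "cell M c = {real c / real M ..< (real c + 1) / real M}"

lemma integral_atLeastLessThan_pderiv:
  fixes q :: "real poly"
  assumes "a \<le> b"
  shows "(\<integral>s. indicator {a..<b} s * poly (pderiv q) s \<partial>lborel) = poly q b - poly q a"
proof -
  have [measurable]: "poly (pderiv q) \<in> borel_measurable borel"
    by (intro borel_measurable_continuous_onI continuous_intros)
  have "(\<integral>s. indicator {a..<b} s * poly (pderiv q) s \<partial>lborel) = (\<integral>s. poly (pderiv q) s * indicator {a..b} s \<partial>lborel)"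
  proof (rule integral_cong_AE)
    show "AE s in lborel. indicator {a..<b} s * poly (pderiv q) s = poly (pderiv q) s * indicator {a..b} s"
      using AE_lborel_singleton[of b] by eventually_elim (auto simp: indicator_def less_le)
  qed auto
  also have "\<dots> = poly q b - poly q a"
    by (rule integral_FTC_Icc_real[OF assms]) (auto intro!: poly_DERIV)
  finally show ?thesis .
qed

lemma integrable_poly_atLeastLessThan:
  "integrable lborel (\<lambda>s::real. indicator {a..<b} s * poly q s)"
proof -
  have i: "integrable lborel (\<lambda>s. indicator {a..b} s *\<^sub>R poly q s)"
    by (rule borel_integrable_compact) (auto intro!: continuous_intros)
  have [measurable]: "poly q \<in> borel_measurable borel"
    by (intro borel_measurable_continuous_onI continuous_intros)
  show ?thesis
    by (rule Bochner_Integration.integrable_bound[OF i]) (auto simp: indicator_def intro!: AE_I2)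
qed

text \<open>
  Polynomials of degree less than \<open>r\<close> can be prescribed by their integrals over the first \<open>r\<close> cells.
  In Newton's manner, one more cell is handled by adding a multiple of the derivative of
  \<open>(x - 0) (x - 1/M) \<cdots> (x - r/M)\<close>: this product vanishes at the end points of all earlier cells,
  so its derivative has integral \<open>0\<close> over them, but not over the next cell.
\<close>

lemma cell_interpolation:
  assumes "0 < M"
  shows "\<exists>q :: real poly. (q = 0 \<or> degree q < r) \<and> (\<forall>c<r. (\<integral>s. indicator (cell M c) s * poly q s \<partial>lborel) = v c)"
proof (induction r)
  case 0
  show ?case by (intro exI[of _ 0]) simp
next
  case (Suc r)
  then obtain q where q: "q = 0 \<or> degree q < r" "\<And>c. c < r \<Longrightarrow> (\<integral>s. indicator (cell M c) s * poly q s \<partial>lborel) = v c"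
    by blast
  \<comment> \<open>The derivative of \<open>p\<close> has degree \<open>r\<close> and integral \<open>0\<close> over \<open>cell M c\<close> for \<open>c < r\<close>.\<close>
  define p where "p = (\<Prod>i\<le>r. [:- (real i / real M), 1:])"
  have dp: "degree p = Suc r" unfolding p_def by (subst degree_prod_eq_sum_degree) auto
  have ev: "poly p x = (\<Prod>i\<le>r. x - real i / real M)" for x by (simp add: p_def poly_prod)
  have z: "poly p (real i / real M) = 0" if "i \<le> r" for i using that by (auto simp: ev)
  have "(real r + 1) / real M \<noteq> real i / real M" if "i \<le> r" for i
    using that assms by simp
  then have nz: "poly p ((real r + 1) / real M) \<noteq> 0" by (auto simp: ev)
  have I: "(\<integral>s. indicator (cell M c) s * poly (pderiv p) s \<partial>lborel) = poly p (real (Suc c) / real M) - poly p (real c / real M)" for c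
    unfolding cell_def by (subst integral_atLeastLessThan_pderiv) (auto simp: divide_right_mono add.commute)
  define J where "J = (\<integral>s. indicator (cell M r) s * poly (pderiv p) s \<partial>lborel)"
  have J: "J \<noteq> 0" using nz z[of r] by (simp add: J_def I add.commute)
  define t where "t = (v r - (\<integral>s. indicator (cell M r) s * poly q s \<partial>lborel)) / J"
  define q' where "q' = q + smult t (pderiv p)"
  have lin: "(\<integral>s. indicator (cell M c) s * poly q' s \<partial>lborel) = (\<integral>s. indicator (cell M c) s * poly q s \<partial>lborel)
     + t * (\<integral>s. indicator (cell M c) s * poly (pderiv p) s \<partial>lborel)" for c
  proof -
    have "(\<integral>s. indicator (cell M c) s * poly q' s \<partial>lborel) = (\<integral>s. indicator (cell M c) s * poly q s + t * (indicator (cell M c) s * poly (pderiv p) s) \<partial>lborel)"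
      by (simp add: q'_def algebra_simps)
    also have "\<dots> = (\<integral>s. indicator (cell M c) s * poly q s \<partial>lborel)
     + t * (\<integral>s. indicator (cell M c) s * poly (pderiv p) s \<partial>lborel)"
      unfolding cell_def by (subst Bochner_Integration.integral_add) (auto intro!: integrable_poly_atLeastLessThan integrable_mult_right)
    finally show ?thesis .
  qed
  have "(\<integral>s. indicator (cell M c) s * poly q' s \<partial>lborel) = v c" if "c < Suc r" for c
  proof (cases "c = r")
    case True
    then show ?thesis using J by (simp add: lin t_def J_def[symmetric])
  next
    case False
    then have "c < r" using that by simp
    then show ?thesis using z[of c] z[of "Suc c"] q(2) by (simp add: lin I del: of_nat_Suc)
  qed
  moreover have "degree q' < Suc r"
  proof -
    have "degree q \<le> r" using q(1) by auto
    moreover have "degree (smult t (pderiv p)) \<le> r" using dp by (simp add: degree_pderiv)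
    ultimately show ?thesis unfolding q'_def using degree_add_le[of q r] by fastforce
  qed
  ultimately show ?case by blast
qed

section \<open>The univariate estimate\<close>

lemma integrable_indicator_mult:
  fixes u :: "real \<Rightarrow> real"
  assumes "integrable lborel u" "A \<in> sets borel"
  shows "integrable lborel (\<lambda>s. indicator A s * u s)"
  using integrable_mult_indicator[of A lborel u] assms by simp

lemma integral_cell_shift:
  fixes u :: "real \<Rightarrow> real"
  assumes "0 < M"
  shows "(\<integral>s. indicator (cell M k) s * u (s + real i / real M) \<partial>lborel) = (\<integral>s. indicator (cell M (k + i)) s * u s \<partial>lborel)"
  using assms by (subst lborel_integral_real_affine[where c=1 and t = "real i / real M" and f = "\<lambda>s. indicator (cell M (k + i)) s * u s"])
     (auto simp: cell_def indicator_def add_divide_distrib add_ac intro!: Bochner_Integration.integral_cong)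

text \<open>
  The sequence of cell integrals of \<open>u\<close> has \<open>r\<close>-th differences equal to the cell integrals of the
  \<open>r\<close>-th difference of \<open>u\<close> with step \<open>1/M\<close>. Since the first \<open>r\<close> members vanish, the recurrence
  determines the sequence and bounds it; the factor grows with \<open>M\<close>, but \<open>M\<close> will depend on \<open>r\<close>
  only.
\<close>

lemma cell_integrals_bounded_by_difference:
  fixes u :: "real \<Rightarrow> real"
  assumes u: "integrable lborel u" and M: "0 < M"
    and z: "\<And>c. c < r \<Longrightarrow> (\<integral>s. indicator (cell M c) s * u s \<partial>lborel) = 0"
    and V: "\<And>k. k + r < M \<Longrightarrow> \<bar>\<integral>s. indicator (cell M k) s * fdiff r (1 / real M) u s \<partial>lborel\<bar> \<le> V"
    and V0: "0 \<le> V"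
  shows "c < M \<Longrightarrow> \<bar>\<integral>s. indicator (cell M c) s * u s \<partial>lborel\<bar> \<le> (1 + 2 ^ r) ^ c * V"
proof (induction c rule: less_induct)
  case (less c)
  let ?I = "\<lambda>c. \<integral>s. indicator (cell M c) s * u s \<partial>lborel"
  show ?case
  proof (cases "c < r")
    case True then show ?thesis using z V0 by simp
  next
    case False
    define k where "k = c - r"
    have c: "c = k + r" using False by (simp add: k_def)
    have int: "integrable lborel (\<lambda>s. indicator (cell M k) s * u (s + real j / real M))" for j
      using lborel_integrable_real_affine[OF u, of 1 "real j / real M"]
      by (intro integrable_indicator_mult) (auto simp: add.commute cell_def)
    have "(\<integral>s. indicator (cell M k) s * fdiff r (1 / real M) u s \<partial>lborel)
       = (\<integral>s. (\<Sum>j\<le>r. (-1) ^ (r - j) * real (r choose j) * (indicator (cell M k) s * u (s + real j / real M))) \<partial>lborel)"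
      by (simp add: fdiff_def sum_distrib_left mult_ac)
    also have "\<dots> = (\<Sum>j\<le>r. (-1) ^ (r - j) * real (r choose j) * ?I (k + j))"
      using int by (subst Bochner_Integration.integral_sum) (auto simp: integral_cell_shift[OF M] intro!: integrable_mult_right)
    also have "\<dots> = (\<Sum>j<r. (-1) ^ (r - j) * real (r choose j) * ?I (k + j)) + ?I c"
      by (simp add: c lessThan_Suc_atMost[symmetric])
    finally have "?I c = (\<integral>s. indicator (cell M k) s * fdiff r (1 / real M) u s \<partial>lborel)
         - (\<Sum>j<r. (-1) ^ (r - j) * real (r choose j) * ?I (k + j))" by simp
    then have "\<bar>?I c\<bar> \<le> \<bar>\<integral>s. indicator (cell M k) s * fdiff r (1 / real M) u s \<partial>lborel\<bar>
         + \<bar>\<Sum>j<r. (-1) ^ (r - j) * real (r choose j) * ?I (k + j)\<bar>" by linarith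
    also have "\<dots> \<le> V + (\<Sum>j<r. real (r choose j) * ((1 + 2 ^ r) ^ (c - 1) * V))"
    proof (intro add_mono V)
      show "k + r < M" using c less by simp
      have "\<bar>\<Sum>j<r. (-1) ^ (r - j) * real (r choose j) * ?I (k + j)\<bar>
          \<le> (\<Sum>j<r. \<bar>(-1) ^ (r - j) * real (r choose j) * ?I (k + j)\<bar>)" by (rule sum_abs)
      also have "\<dots> \<le> (\<Sum>j<r. real (r choose j) * ((1 + 2 ^ r) ^ (c - 1) * V))"
      proof (intro sum_mono)
        fix j assume "j \<in> {..<r}"
        then have j: "k + j < c" using c by simp
        have "\<bar>?I (k + j)\<bar> \<le> (1 + 2 ^ r) ^ (k + j) * V" using less j by simp
        also have "\<dots> \<le> (1 + 2 ^ r) ^ (c - 1) * V"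
          using j V0 by (intro mult_right_mono power_increasing) auto
        finally show "\<bar>(-1) ^ (r - j) * real (r choose j) * ?I (k + j)\<bar> \<le> real (r choose j) * ((1 + 2 ^ r) ^ (c - 1) * V)"
          by (simp add: abs_mult mult_left_mono)
      qed
      finally show "\<bar>\<Sum>j<r. (-1) ^ (r - j) * real (r choose j) * ?I (k + j)\<bar> \<le> (\<Sum>j<r. real (r choose j) * ((1 + 2 ^ r) ^ (c - 1) * V))" .
    qed
    also have "(\<Sum>j<r. real (r choose j) * ((1 + 2 ^ r) ^ (c - 1) * V)) = (2 ^ r - 1) * ((1 + 2 ^ r) ^ (c - 1) * V)"
    proof -
      have "(\<Sum>j\<le>r. real (r choose j)) = 2 ^ r" by (rule sum_binomials)
      then have "(\<Sum>j<r. real (r choose j)) = 2 ^ r - 1" by (simp add: lessThan_Suc_atMost[symmetric])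
      then show ?thesis by (simp add: sum_distrib_right[symmetric])
    qed
    also have "V + (2 ^ r - 1) * ((1 + 2 ^ r) ^ (c - 1) * V) \<le> (1 + 2 ^ r) ^ c * V"
    proof (cases c)
      case 0
      then have "r = 0" using c by simp
      then show ?thesis using 0 by simp
    next
      case (Suc n)
      have "1 * V \<le> (1 + 2 ^ r) ^ n * V" using V0 by (intro mult_right_mono one_le_power) auto
      then show ?thesis using V0 by (simp add: Suc algebra_simps)
    qed
    finally show ?thesis .
  qed
qed

text \<open>
  An initial segment consists of full cells and of a last piece of length less than \<open>1/M\<close>. The
  integral over this last piece is the only place where \<open>u\<close> itself, and not its differences, remains;
  the short length is what makes the term absorbable.
\<close>

lemma primitive_bounded_by_cells:
  fixes u :: "real \<Rightarrow> real"
  assumes u: "integrable lborel u" and M: "0 < M" and t: "0 \<le> t" "t \<le> 1"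
  shows "\<bar>\<integral>s. indicator {0..<t} s * u s \<partial>lborel\<bar> \<le> (\<Sum>c<M. \<bar>\<integral>s. indicator (cell M c) s * u s \<partial>lborel\<bar>)
     + (\<integral>s. indicator {t - 1 / real M..<t} s * \<bar>u s\<bar> \<partial>lborel)"
proof -
  \<comment> \<open>the number of cells that lie completely to the left of \<open>t\<close>\<close>
  define n where "n = nat \<lfloor>real M * t\<rfloor>"
  have n: "real n \<le> real M * t" "real M * t < real n + 1" using M t by (auto simp: n_def)
  have "real n \<le> real M" using n(1) t M by (meson mult_left_le of_nat_0_le_iff order_trans)
  then have nM: "n \<le> M" by simp
  have n': "real n / real M \<le> t" "t - 1 / real M < real n / real M"
    using n M by (auto simp: pos_divide_le_eq pos_less_divide_eq right_diff_distrib left_diff_distrib mult.commute)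
  have cells: "(\<integral>s. indicator {0..<real m / real M} s * u s \<partial>lborel) = (\<Sum>c<m. \<integral>s. indicator (cell M c) s * u s \<partial>lborel)" for m
  proof (induction m)
    case (Suc m)
    have "indicator {0..<real (Suc m) / real M} s * u s = indicator {0..<real m / real M} s * u s + indicator (cell M m) s * u s" for s
    proof -
      define x y where "x = real m / real M" and "y = real (Suc m) / real M"
      have "0 \<le> x" "x \<le> y" using M by (auto simp: x_def y_def intro: divide_right_mono)
      then have "indicator {0..<y} s * u s = indicator {0..<x} s * u s + indicator {x..<y} s * u s"
        by (auto simp: indicator_def)
      then show ?thesis by (simp add: cell_def x_def y_def add.commute)
    qed
    then show ?case using Suc u
      by (simp add: integrable_indicator_mult cell_def)
  qed simp
  have split: "indicator {0..<t} s * u s = indicator {0..<x} s * u s + indicator {x..<t} s * u s"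
    if "0 \<le> x" "x \<le> t" for x s
    using that by (auto simp: indicator_def)
  have "indicator {0..<t} s * u s = indicator {0..<real n / real M} s * u s + indicator {real n / real M..<t} s * u s" for s
    by (rule split) (use n' in simp_all)
  then have "(\<integral>s. indicator {0..<t} s * u s \<partial>lborel) = (\<Sum>c<n. \<integral>s. indicator (cell M c) s * u s \<partial>lborel)
     + (\<integral>s. indicator {real n / real M..<t} s * u s \<partial>lborel)"
    using u by (simp add: integrable_indicator_mult cells)
  also have "\<bar>\<dots>\<bar> \<le> (\<Sum>c<n. \<bar>\<integral>s. indicator (cell M c) s * u s \<partial>lborel\<bar>) + \<bar>\<integral>s. indicator {real n / real M..<t} s * u s \<partial>lborel\<bar>"
    by (intro order.trans[OF abs_triangle_ineq] add_mono sum_abs order_refl)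
  also have "\<dots> \<le> (\<Sum>c<M. \<bar>\<integral>s. indicator (cell M c) s * u s \<partial>lborel\<bar>) + (\<integral>s. indicator {t - 1 / real M..<t} s * \<bar>u s\<bar> \<partial>lborel)"
  proof (intro add_mono sum_mono2)
    have "\<bar>\<integral>s. indicator {real n / real M..<t} s * u s \<partial>lborel\<bar> \<le> (\<integral>s. \<bar>indicator {real n / real M..<t} s * u s\<bar> \<partial>lborel)"
      by (rule integral_abs_bound)
    also have "\<dots> \<le> (\<integral>s. indicator {t - 1 / real M..<t} s * \<bar>u s\<bar> \<partial>lborel)"
      by (intro integral_mono integrable_abs integrable_indicator_mult u)
         (use n' in \<open>auto simp: indicator_def\<close>)
    finally show "\<bar>\<integral>s. indicator {real n / real M..<t} s * u s \<partial>lborel\<bar> \<le> \<dots>" .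
  qed (use nM in auto)
  finally show ?thesis .
qed

lemma integral_along_segment:
  fixes u :: "real \<Rightarrow> real"
  assumes u: "integrable lborel u" and t: "0 \<le> t" "0 \<le> t + c" and c: "c \<noteq> 0"
  shows "(\<integral>\<theta>. indicator {0..1} \<theta> * u (t + c * \<theta>) \<partial>lborel)
     = ((\<integral>s. indicator {0..<t + c} s * u s \<partial>lborel) - (\<integral>s. indicator {0..<t} s * u s \<partial>lborel)) / c"
    and "integrable lborel (\<lambda>\<theta>. indicator {0..1} \<theta> * u (t + c * \<theta>))"
proof -
  have [measurable]: "u \<in> borel_measurable borel" using u by auto
  show "integrable lborel (\<lambda>\<theta>. indicator {0..1} \<theta> * u (t + c * \<theta>))"
    using lborel_integrable_real_affine[OF u c, of t] by (intro integrable_indicator_mult) auto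
  define J where "J x y = (\<integral>s. indicator {x..<y} s * u s \<partial>lborel)" for x y
  have add: "J 0 y = J 0 x + J x y" if "0 \<le> x" "x \<le> y" for x y
  proof -
    have "indicator {0..<y} s * u s = indicator {0..<x} s * u s + indicator {x..<y} s * u s" for s
      using that by (auto simp: indicator_def)
    then show ?thesis using u unfolding J_def by (simp add: integrable_indicator_mult)
  qed
  show "(\<integral>\<theta>. indicator {0..1} \<theta> * u (t + c * \<theta>) \<partial>lborel)
     = ((\<integral>s. indicator {0..<t + c} s * u s \<partial>lborel) - (\<integral>s. indicator {0..<t} s * u s \<partial>lborel)) / c"
  proof (cases "c > 0")
    case True
    have "J t (t + c) = \<bar>c\<bar> *\<^sub>R (\<integral>\<theta>. indicator {t..<t+c} (t + c * \<theta>) * u (t + c * \<theta>) \<partial>lborel)"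
      unfolding J_def by (rule lborel_integral_real_affine[OF c])
    also have "(\<integral>\<theta>. indicator {t..<t+c} (t + c * \<theta>) * u (t + c * \<theta>) \<partial>lborel) = (\<integral>\<theta>. indicator {0..1} \<theta> * u (t + c * \<theta>) \<partial>lborel)"
    proof (rule integral_cong_AE)
      show "AE \<theta> in lborel. indicator {t..<t+c} (t + c * \<theta>) * u (t + c * \<theta>) = indicator {0..1} \<theta> * u (t + c * \<theta>)"
        using AE_lborel_singleton[of 1] by eventually_elim (use True in \<open>auto simp: indicator_def zero_le_mult_iff\<close>)
    qed auto
    finally show ?thesis using add[of t "t + c"] t True unfolding J_def[symmetric] by (simp add: field_simps)
  next
    case False
    then have c': "c < 0" using c by simp
    have "J (t + c) t = \<bar>c\<bar> *\<^sub>R (\<integral>\<theta>. indicator {t+c..<t} (t + c * \<theta>) * u (t + c * \<theta>) \<partial>lborel)"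
      unfolding J_def by (rule lborel_integral_real_affine[OF c])
    also have "(\<integral>\<theta>. indicator {t+c..<t} (t + c * \<theta>) * u (t + c * \<theta>) \<partial>lborel) = (\<integral>\<theta>. indicator {0..1} \<theta> * u (t + c * \<theta>) \<partial>lborel)"
    proof (rule integral_cong_AE)
      show "AE \<theta> in lborel. indicator {t+c..<t} (t + c * \<theta>) * u (t + c * \<theta>) = indicator {0..1} \<theta> * u (t + c * \<theta>)"
        using AE_lborel_singleton[of 0] by eventually_elim (use c' in \<open>auto simp: indicator_def mult_less_0_iff\<close>)
    qed auto
    finally show ?thesis using add[of "t + c" t] t c' unfolding J_def[symmetric] by (simp add: field_simps)
  qed
qed

text \<open>
  The difference \<open>fdiff r \<eta> u t\<close> contains \<open>u t\<close> with coefficient \<open>\<plusminus>1\<close>. Averaged over the steps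
  \<open>\<eta>\<close> between \<open>0\<close> and \<open>h\<close>, each other term becomes a divided difference of the primitive \<open>U\<close>. The sign
  \<open>\<sigma>\<close> chooses the direction of the steps; the total displacement \<open>r h = \<sigma>/2\<close> keeps one of the
  two choices inside the unit interval for every \<open>t\<close> in it.
\<close>

lemma value_bounded_by_difference_and_primitive:
  fixes u :: "real \<Rightarrow> real"
  assumes u: "integrable lborel u" and r: "1 \<le> r" and \<sigma>: "\<bar>\<sigma>\<bar> = 1"
    and t: "0 \<le> t" "0 \<le> t + \<sigma> / 2"
  defines "U \<equiv> \<lambda>x. \<integral>s. indicator {0..<x} s * u s \<partial>lborel"
  defines "h \<equiv> \<sigma> / (2 * real r)"
  shows "\<bar>u t\<bar> \<le> (\<integral>\<theta>. indicator {0..1} \<theta> * \<bar>fdiff r (h * \<theta>) u t\<bar> \<partial>lborel)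
     + 2 * real r * (\<Sum>j\<le>r. real (r choose j) * (\<bar>U (t + real j * h)\<bar> + \<bar>U t\<bar>))"
proof -
  have h: "h \<noteq> 0" using \<sigma> r by (auto simp: h_def)
  have tj: "0 \<le> t + real j * h" if "j \<le> r" for j
  proof -
    have "real j * h = (real j / real r) * (\<sigma> / 2)" by (simp add: h_def)
    moreover have "t + (real j / real r) * (\<sigma> / 2) = (1 - real j / real r) * t + (real j / real r) * (t + \<sigma> / 2)"
      by (simp add: algebra_simps)
    moreover have "0 \<le> 1 - real j / real r" using that r by simp
    then have "0 \<le> (1 - real j / real r) * t + (real j / real r) * (t + \<sigma> / 2)"
      using t by (intro add_nonneg_nonneg[OF mult_nonneg_nonneg mult_nonneg_nonneg]) simp_all
    ultimately show ?thesis by simp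
  qed
  have seg: "(\<integral>\<theta>. indicator {0..1} \<theta> * u (t + real j * (h * \<theta>)) \<partial>lborel) = (U (t + real j * h) - U t) / (real j * h)"
    "integrable lborel (\<lambda>\<theta>. indicator {0..1} \<theta> * u (t + real j * (h * \<theta>)))" if "j \<in> {1..r}" for j
    using integral_along_segment[OF u t(1) tj[of j]] that h by (auto simp: U_def mult.assoc)
  have i0: "integrable lborel (\<lambda>\<theta>::real. indicator {0..1} \<theta> * u t)" by simp
  define S where "S = (\<lambda>\<theta>. \<Sum>j=1..r. (-1) ^ (r - j) * real (r choose j) * (indicator {0..1} \<theta> * u (t + real j * (h * \<theta>))))"
  have fd: "indicator {0..1} \<theta> * fdiff r (h * \<theta>) u t = (-1) ^ r * (indicator {0..1} \<theta> * u t) + S \<theta>" for \<theta>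
  proof -
    have "{..r} = insert 0 {1..r}" by auto
    then show ?thesis by (simp add: fdiff_def S_def sum_distrib_left algebra_simps)
  qed
  have iS: "integrable lborel S" unfolding S_def using seg by (auto intro!: Bochner_Integration.integrable_sum)
  have ifd: "integrable lborel (\<lambda>\<theta>. indicator {0..1} \<theta> * fdiff r (h * \<theta>) u t)"
    unfolding fd using i0 iS by auto
  have "(\<integral>\<theta>. indicator {0..1} \<theta> * fdiff r (h * \<theta>) u t \<partial>lborel) = (-1) ^ r * u t + (\<integral>\<theta>. S \<theta> \<partial>lborel)"
    unfolding fd using i0 iS by simp
  also have "(\<integral>\<theta>. S \<theta> \<partial>lborel) = (\<Sum>j=1..r. (-1) ^ (r - j) * real (r choose j) * ((U (t + real j * h) - U t) / (real j * h)))"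
    unfolding S_def using seg by (subst Bochner_Integration.integral_sum) auto
  finally have "\<bar>u t\<bar> = \<bar>(\<integral>\<theta>. indicator {0..1} \<theta> * fdiff r (h * \<theta>) u t \<partial>lborel) - \<dots>\<bar>"
    by (simp add: abs_mult)
  also have "\<dots> \<le> \<bar>\<integral>\<theta>. indicator {0..1} \<theta> * fdiff r (h * \<theta>) u t \<partial>lborel\<bar>
     + \<bar>\<Sum>j=1..r. (-1) ^ (r - j) * real (r choose j) * ((U (t + real j * h) - U t) / (real j * h))\<bar>" by (rule abs_triangle_ineq4)
  also have "\<bar>\<integral>\<theta>. indicator {0..1} \<theta> * fdiff r (h * \<theta>) u t \<partial>lborel\<bar> \<le> (\<integral>\<theta>. indicator {0..1} \<theta> * \<bar>fdiff r (h * \<theta>) u t\<bar> \<partial>lborel)"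
    by (rule order.trans[OF integral_abs_bound]) (simp add: abs_mult)
  also have "\<bar>\<Sum>j=1..r. (-1) ^ (r - j) * real (r choose j) * ((U (t + real j * h) - U t) / (real j * h))\<bar>
      \<le> (\<Sum>j=1..r. real (r choose j) * (2 * real r * (\<bar>U (t + real j * h)\<bar> + \<bar>U t\<bar>)))"
  proof (intro order.trans[OF sum_abs] sum_mono)
    fix j assume j: "j \<in> {1..r}"
    have "1 \<le> real j" using j by simp
    then have "inverse (real j * \<bar>h\<bar>) \<le> 2 * real r" using \<sigma> r by (simp add: h_def abs_divide field_simps)
    then have "\<bar>(U (t + real j * h) - U t) / (real j * h)\<bar> \<le> (\<bar>U (t + real j * h)\<bar> + \<bar>U t\<bar>) * (2 * real r)"
      unfolding divide_inverse abs_mult abs_inverse abs_of_nat by (intro mult_mono) (auto simp: abs_triangle_ineq4)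
    then show "\<bar>(-1) ^ (r - j) * real (r choose j) * ((U (t + real j * h) - U t) / (real j * h))\<bar>
      \<le> real (r choose j) * (2 * real r * (\<bar>U (t + real j * h)\<bar> + \<bar>U t\<bar>))"
      unfolding abs_mult by (simp add: mult_left_mono mult.commute del: times_divide_eq_right)
  qed
  also have "\<dots> \<le> (\<Sum>j\<le>r. real (r choose j) * (2 * real r * (\<bar>U (t + real j * h)\<bar> + \<bar>U t\<bar>)))"
    by (intro sum_mono2) auto
  also have "\<dots> = 2 * real r * (\<Sum>j\<le>r. real (r choose j) * (\<bar>U (t + real j * h)\<bar> + \<bar>U t\<bar>))"
    by (simp add: sum_distrib_left mult_ac)
  finally show ?thesis by simp
qed

text \<open>
  The univariate core. All integrals on the right are averages over \<open>\<theta> \<in> [0,1]\<close> of translates of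
  \<open>u\<close> or of its differences, so that Minkowski's inequality and translation invariance turn the
  bound into one for norms. The coefficient of the terms with \<open>u\<close> has the factor \<open>1/M\<close>, whereas
  the large constant multiplies only differences.
\<close>

lemma pointwise_bound:
  fixes u :: "real \<Rightarrow> real"
  assumes u: "integrable lborel u" and r: "1 \<le> r" and M: "0 < M" and \<sigma>: "\<bar>\<sigma>\<bar> = 1"
    and t: "0 \<le> t" "t \<le> 1" "0 \<le> t + \<sigma> / 2" "t + \<sigma> / 2 \<le> 1"
    and z: "\<And>c. c < r \<Longrightarrow> (\<integral>s. indicator (cell M c) s * u s \<partial>lborel) = 0"
  defines "h \<equiv> \<sigma> / (2 * real r)"
  defines "w \<equiv> \<lambda>s. indicator {0..1 - real r / real M} s * fdiff r (1 / real M) u s"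
  shows "\<bar>u t\<bar> \<le> (\<integral>\<theta>. indicator {0..1} \<theta> * \<bar>fdiff r (h * \<theta>) u t\<bar> \<partial>lborel)
     + 8 * real r * 2 ^ r * real M * (1 + 2 ^ r) ^ M * (\<integral>\<theta>. indicator {0..1} \<theta> * \<bar>w (t + (2 * \<theta> - 1))\<bar> \<partial>lborel)
     + 2 * real r / real M * (\<Sum>j\<le>r. real (r choose j) *
         ((\<integral>\<theta>. indicator {0..1} \<theta> * \<bar>u (t + (real j * h - \<theta> / real M))\<bar> \<partial>lborel)
          + (\<integral>\<theta>. indicator {0..1} \<theta> * \<bar>u (t + (- \<theta> / real M))\<bar> \<partial>lborel)))"
proof -
  have [measurable]: "u \<in> borel_measurable borel" using u by auto
  define V where "V = (\<integral>s. \<bar>w s\<bar> \<partial>lborel)"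
  define I where "I c = \<bar>\<integral>s. indicator (cell M c) s * u s \<partial>lborel\<bar>" for c
  define U where "U x = (\<integral>s. indicator {0..<x} s * u s \<partial>lborel)" for x
  have ifd: "integrable lborel (fdiff r (1 / real M) u)"
  proof -
    have "integrable lborel (\<lambda>x. u (x + c))" for c
      using lborel_integrable_real_affine[OF u, of 1 c] by (simp add: add.commute)
    then show ?thesis unfolding fdiff_def by (auto intro!: Bochner_Integration.integrable_sum)
  qed
  have iw: "integrable lborel w" unfolding w_def by (intro integrable_indicator_mult ifd) auto
  have V0: "0 \<le> V" unfolding V_def by simp
  have V: "\<bar>\<integral>s. indicator (cell M k) s * fdiff r (1 / real M) u s \<partial>lborel\<bar> \<le> V" if "k + r < M" for k
  proof -
    have "cell M k \<subseteq> {0..1 - real r / real M}"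
    proof
      fix s assume s: "s \<in> cell M k"
      have "real k + 1 + real r \<le> real M" using that by linarith
      then have "(real k + 1) / real M + real r / real M \<le> 1" using M by (simp add: add_divide_distrib[symmetric])
      moreover have "0 \<le> real k / real M" by simp
      ultimately show "s \<in> {0..1 - real r / real M}" using s unfolding cell_def atLeastLessThan_iff atLeastAtMost_iff by linarith
    qed
    then have eq: "(\<lambda>s. indicator (cell M k) s * fdiff r (1 / real M) u s) = (\<lambda>s. indicator (cell M k) s * w s)"
      by (auto simp: w_def indicator_def fun_eq_iff)
    have "\<bar>\<integral>s. indicator (cell M k) s * fdiff r (1 / real M) u s \<partial>lborel\<bar> \<le> (\<integral>s. \<bar>indicator (cell M k) s * w s\<bar> \<partial>lborel)"
      unfolding eq by (rule integral_abs_bound)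
    also have "\<dots> \<le> V" unfolding V_def
      by (intro integral_mono integrable_abs integrable_indicator_mult iw) (auto simp: cell_def indicator_def)
    finally show ?thesis .
  qed
  have "(\<Sum>c<M. I c) \<le> (\<Sum>c<M. (1 + 2 ^ r) ^ M * V)"
  proof (intro sum_mono)
    fix c assume c: "c \<in> {..<M}"
    have "I c \<le> (1 + 2 ^ r) ^ c * V"
      unfolding I_def using c by (intro cell_integrals_bounded_by_difference[OF u M z V V0]) auto
    also have "\<dots> \<le> (1 + 2 ^ r) ^ M * V" using c V0 by (intro mult_right_mono power_increasing) auto
    finally show "I c \<le> \<dots>" .
  qed
  then have I: "(\<Sum>c<M. I c) \<le> real M * (1 + 2 ^ r) ^ M * V" by simp
  have edge: "(\<integral>s. indicator {x - 1 / real M..<x} s * \<bar>u s\<bar> \<partial>lborel)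
     = (1 / real M) * (\<integral>\<theta>. indicator {0..1} \<theta> * \<bar>u (x - \<theta> / real M)\<bar> \<partial>lborel)" for x
  proof -
    have "(\<integral>s. indicator {x - 1 / real M..<x} s * \<bar>u s\<bar> \<partial>lborel)
       = \<bar>- 1 / real M\<bar> *\<^sub>R (\<integral>\<theta>. indicator {x - 1 / real M..<x} (x + (-1 / real M) * \<theta>) * \<bar>u (x + (-1 / real M) * \<theta>)\<bar> \<partial>lborel)"
      by (rule lborel_integral_real_affine) (use M in auto)
    also have "(\<integral>\<theta>. indicator {x - 1 / real M..<x} (x + (-1 / real M) * \<theta>) * \<bar>u (x + (-1 / real M) * \<theta>)\<bar> \<partial>lborel)
      = (\<integral>\<theta>. indicator {0..1} \<theta> * \<bar>u (x - \<theta> / real M)\<bar> \<partial>lborel)"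
    proof (rule integral_cong_AE)
      show "AE \<theta> in lborel. indicator {x - 1 / real M..<x} (x + (-1 / real M) * \<theta>) * \<bar>u (x + (-1 / real M) * \<theta>)\<bar>
         = indicator {0..1} \<theta> * \<bar>u (x - \<theta> / real M)\<bar>"
        using AE_lborel_singleton[of 0] by eventually_elim (use M in \<open>auto simp: indicator_def field_simps\<close>)
    qed auto
    finally show ?thesis by simp
  qed
  have U: "\<bar>U x\<bar> \<le> real M * (1 + 2 ^ r) ^ M * V + (1 / real M) * (\<integral>\<theta>. indicator {0..1} \<theta> * \<bar>u (x - \<theta> / real M)\<bar> \<partial>lborel)"
    if "0 \<le> x" "x \<le> 1" for x
    using primitive_bounded_by_cells[OF u M that] I unfolding I_def U_def edge by linarith
  have tj: "0 \<le> t + real j * h \<and> t + real j * h \<le> 1" if "j \<le> r" for j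
  proof -
    define \<mu> where "\<mu> = real j / real r"
    have \<mu>: "0 \<le> \<mu>" "\<mu> \<le> 1" using that by (auto simp: \<mu>_def divide_le_eq_1)
    have "t + real j * h = (1 - \<mu>) * t + \<mu> * (t + \<sigma> / 2)" by (simp add: h_def \<mu>_def algebra_simps)
    moreover have "0 \<le> (1 - \<mu>) * t + \<mu> * (t + \<sigma> / 2)" using \<mu> t by simp
    moreover have "(1 - \<mu>) * t + \<mu> * (t + \<sigma> / 2) \<le> 1" using \<mu> t by (intro convex_bound_le) auto
    ultimately show ?thesis by simp
  qed
  \<comment> \<open>As \<open>t \<in> [0,1]\<close>, the displacements \<open>2 \<theta> - 1 \<in> [-1,1]\<close> cover the support of \<open>w\<close>.\<close>
  have Veq: "V = 2 * (\<integral>\<theta>. indicator {0..1} \<theta> * \<bar>w (t + (2 * \<theta> - 1))\<bar> \<partial>lborel)"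
  proof -
    have "V = \<bar>2\<bar> *\<^sub>R (\<integral>\<theta>. \<bar>w ((t - 1) + 2 * \<theta>)\<bar> \<partial>lborel)"
      unfolding V_def by (rule lborel_integral_real_affine) simp
    also have "(\<integral>\<theta>. \<bar>w ((t - 1) + 2 * \<theta>)\<bar> \<partial>lborel) = (\<integral>\<theta>. indicator {0..1} \<theta> * \<bar>w (t + (2 * \<theta> - 1))\<bar> \<partial>lborel)"
    proof (intro Bochner_Integration.integral_cong refl)
      fix \<theta> :: real
      have "w (t + (2 * \<theta> - 1)) = 0" if "\<theta> \<notin> {0..1}"
      proof -
        have "0 \<le> real r / real M" by simp
        then have "t + (2 * \<theta> - 1) \<notin> {0..1 - real r / real M}" using that t unfolding atLeastAtMost_iff by linarith
        then show ?thesis by (simp add: w_def)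
      qed
      then show "\<bar>w ((t - 1) + 2 * \<theta>)\<bar> = indicator {0..1} \<theta> * \<bar>w (t + (2 * \<theta> - 1))\<bar>"
        by (auto simp: indicator_def algebra_simps)
    qed
    finally show ?thesis by simp
  qed
  let ?E = "\<lambda>x. \<integral>\<theta>. indicator {0..1} \<theta> * \<bar>u (x - \<theta> / real M)\<bar> \<partial>lborel"
  have "(\<Sum>j\<le>r. real (r choose j) * (\<bar>U (t + real j * h)\<bar> + \<bar>U t\<bar>))
     \<le> (\<Sum>j\<le>r. real (r choose j) * (2 * (real M * (1 + 2 ^ r) ^ M * V) + (1 / real M) * (?E (t + real j * h) + ?E t)))"
  proof (intro sum_mono mult_left_mono)
    fix j assume "j \<in> {..r}"
    then have j: "j \<le> r" by simp
    show "\<bar>U (t + real j * h)\<bar> + \<bar>U t\<bar> \<le> 2 * (real M * (1 + 2 ^ r) ^ M * V) + (1 / real M) * (?E (t + real j * h) + ?E t)"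
      using U[of "t + real j * h"] U[of t] tj[OF j] t unfolding distrib_left by linarith
  qed simp
  also have "\<dots> = 2 ^ r * (2 * (real M * (1 + 2 ^ r) ^ M * V)) + (1 / real M) * (\<Sum>j\<le>r. real (r choose j) * (?E (t + real j * h) + ?E t))"
  proof -
    have "(\<Sum>j\<le>r. real (r choose j)) = 2 ^ r" by (rule sum_binomials)
    moreover have "(\<Sum>j\<le>r. c j * (A + m * E j)) = (\<Sum>j\<le>r. c j) * A + m * (\<Sum>j\<le>r. c j * E j)" for c E :: "nat \<Rightarrow> real" and A m
      by (simp add: distrib_left sum.distrib sum_distrib_right sum_distrib_left mult_ac)
    ultimately show ?thesis by (simp only:)
  qed
  finally have "2 * real r * (\<Sum>j\<le>r. real (r choose j) * (\<bar>U (t + real j * h)\<bar> + \<bar>U t\<bar>))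
     \<le> 2 * real r * (2 ^ r * (2 * (real M * (1 + 2 ^ r) ^ M * V)) + (1 / real M) * (\<Sum>j\<le>r. real (r choose j) * (?E (t + real j * h) + ?E t)))"
    by (intro mult_left_mono) auto
  also have "\<dots> = 8 * real r * 2 ^ r * real M * (1 + 2 ^ r) ^ M * (\<integral>\<theta>. indicator {0..1} \<theta> * \<bar>w (t + (2 * \<theta> - 1))\<bar> \<partial>lborel)
     + 2 * real r / real M * (\<Sum>j\<le>r. real (r choose j) * (?E (t + real j * h) + ?E t))"
    unfolding Veq distrib_left by (simp add: mult_ac)
  finally show ?thesis
    using value_bounded_by_difference_and_primitive[OF u r \<sigma> t(1,3)]
    unfolding h_def[symmetric] U_def by (simp add: add_diff_eq)
qed

section \<open>Integration along the edges of a box\<close>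

text \<open>
  The edge of direction \<open>l\<close> through \<open>x\<close>, scaled so that it meets the box \<open>[a, b]\<close> at the parameters
  in \<open>[0,1]\<close>; \<open>par\<close> is the parameter of \<open>x\<close> itself.
\<close>

definition line :: "'d \<Rightarrow> real ^ 'd \<Rightarrow> real ^ 'd \<Rightarrow> real ^ 'd \<Rightarrow> real \<Rightarrow> real ^ 'd" where
  "line l a b x s = (\<chi> k. if k = l then a $ l + (b $ l - a $ l) * s else x $ k)"

definition par :: "'d \<Rightarrow> real ^ 'd \<Rightarrow> real ^ 'd \<Rightarrow> real ^ 'd \<Rightarrow> real" where
  "par l a b x = (x $ l - a $ l) / (b $ l - a $ l)"

lemma line_line [simp]: "line l a b (line l a b x s) t = line l a b x t"
  by (simp add: line_def vec_eq_iff)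

lemma par_line [simp]: "a $ l < b $ l \<Longrightarrow> par l a b (line l a b x s) = s"
  by (simp add: line_def par_def)

lemma line_par_add: "a $ l < b $ l \<Longrightarrow> line l a b x (par l a b x + \<eta>) = x + (\<eta> * (b $ l - a $ l)) *\<^sub>R axis l 1"
  by (auto simp: line_def par_def vec_eq_iff axis_def field_simps)

lemma line_par [simp]: "a $ l < b $ l \<Longrightarrow> line l a b x (par l a b x) = x"
  using line_par_add[of a l b x 0] by simp

lemma line_in_cbox:
  assumes "a $ l < b $ l" "x \<in> cbox a b"
  shows "line l a b x s \<in> cbox a b \<longleftrightarrow> s \<in> {0..1}"
proof -
  have "a $ l \<le> a $ l + (b $ l - a $ l) * s \<and> a $ l + (b $ l - a $ l) * s \<le> b $ l \<longleftrightarrow> s \<in> {0..1}"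
  proof -
    have "a $ l + (b $ l - a $ l) * s \<le> b $ l \<longleftrightarrow> (b $ l - a $ l) * s \<le> (b $ l - a $ l) * 1" by auto
    then show ?thesis using assms(1) by (simp add: zero_le_mult_iff)
  qed
  then show ?thesis using assms(2) by (auto simp: line_def mem_box_cart split: if_splits)
qed

lemma par_in_cbox: "a $ l < b $ l \<Longrightarrow> x \<in> cbox a b \<Longrightarrow> 0 \<le> par l a b x \<and> par l a b x \<le> 1"
  by (auto simp: par_def mem_box_cart divide_le_eq_1 intro!: divide_nonneg_pos)

lemma measurable_par [measurable]: "par l a b \<in> borel_measurable borel"
  unfolding par_def by (intro borel_measurable_divide borel_measurable_continuous_onI continuous_intros)

lemma measurable_line: "(\<lambda>(x, s). line l a b x s) \<in> borel_measurable (borel \<Otimes>\<^sub>M borel)"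
proof -
  have "continuous_on UNIV (\<lambda>z. line l a b (fst z) (snd z))"
    unfolding line_def
    by (intro continuous_on_vec_lambda; rename_tac k; case_tac "k = l") (auto intro!: continuous_intros)
  then show ?thesis unfolding borel_prod case_prod_beta' by (rule borel_measurable_continuous_onI)
qed

lemma measurable_line_comp [measurable (raw)]:
  assumes "f \<in> borel_measurable N" "g \<in> borel_measurable N"
  shows "(\<lambda>z. line l a b (f z) (g z)) \<in> borel_measurable N"
  using measurable_compose[OF measurable_Pair[OF assms] measurable_line] by simp

definition slice_integrable where
  "slice_integrable l a b f x \<longleftrightarrow> integrable lborel (\<lambda>s. indicator {0..1} s * f (line l a b x s))"

text \<open>
  Integrating \<open>\<bar>f\<bar>\<close> over a segment of direction \<open>l\<close> is, up to scaling, integrating its translates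
  \<open>x + \<eta> \<delta> e\<close> with \<open>\<eta> \<in> [-1,1]\<close>. So Tonelli's theorem over \<open>\<eta>\<close> and the whole space replaces a
  decomposition of the space into a line and a hyperplane.
\<close>

lemma AE_slice_integrable:
  fixes f :: "real ^ 'd \<Rightarrow> real"
  assumes ab: "a $ l < b $ l" and F: "Lp_le 1 (\<lambda>x. indicator (cbox a b) x * f x) B"
    and [measurable]: "f \<in> borel_measurable borel"
  shows "AE x in lborel. x \<in> cbox a b \<longrightarrow> slice_integrable l a b f x"
proof -
  define F where "F x = indicator (cbox a b) x * f x" for x
  have [measurable]: "F \<in> borel_measurable borel" unfolding F_def by measurable
  define e :: "real ^ 'd" where "e = axis l 1"
  define \<delta> where "\<delta> = b $ l - a $ l"
  have FB: "Lp_le 1 F B" using F unfolding F_def .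
  have FF: "(\<integral>\<^sup>+x. ennreal \<bar>F (x + v)\<bar> \<partial>lborel) \<le> ennreal B" for v
    using Lp_le_translate[OF FB, of v] by (auto simp: Lp_le_def)
  define G where "G x = (\<integral>\<^sup>+\<eta>. indicator {-1..1} \<eta> * ennreal \<bar>F (x + (\<eta> * \<delta>) *\<^sub>R e)\<bar> \<partial>lborel)" for x
  have m: "(\<lambda>(\<eta>, x). F (x + (\<eta> * \<delta>) *\<^sub>R e)) \<in> borel_measurable (borel \<Otimes>\<^sub>M borel)" by measurable
  have m': "(\<lambda>(\<eta>, x). indicator {-1..1} \<eta> * ennreal \<bar>F (x + (\<eta> * \<delta>) *\<^sub>R e)\<bar>) \<in> borel_measurable (lborel \<Otimes>\<^sub>M lborel)" by measurable
  have mG: "G \<in> borel_measurable lborel" unfolding G_def by measurable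
  have "(\<integral>\<^sup>+x. G x \<partial>lborel) = (\<integral>\<^sup>+\<eta>. (\<integral>\<^sup>+x. indicator {-1..1} \<eta> * ennreal \<bar>F (x + (\<eta> * \<delta>) *\<^sub>R e)\<bar> \<partial>lborel) \<partial>lborel)"
    unfolding G_def by (rule lborel_pair.Fubini'[OF m'])
  also have "\<dots> \<le> (\<integral>\<^sup>+\<eta>. ennreal B * indicator {-1..1::real} \<eta> \<partial>lborel)"
    using FF by (intro nn_integral_mono) (auto simp: indicator_def)
  also have "\<dots> < \<infinity>" by (simp add: nn_integral_cmult ennreal_mult_less_top)
  finally have "AE x in lborel. G x \<noteq> \<infinity>" by (intro nn_integral_PInf_AE mG) auto
  then show ?thesis
  proof eventually_elim
    case (elim x)
    show ?case
    proof
      assume x: "x \<in> cbox a b"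
      let ?\<tau> = "par l a b x"
      have "(\<integral>\<^sup>+s. ennreal (norm (indicator {0..1} s * f (line l a b x s))) \<partial>lborel)
         = (\<integral>\<^sup>+s. ennreal \<bar>F (line l a b x s)\<bar> \<partial>lborel)"
        by (intro nn_integral_cong) (auto simp: F_def indicator_def line_in_cbox[of a l b, OF ab x])
      also have "\<dots> = (\<integral>\<^sup>+\<eta>. ennreal \<bar>F (line l a b x (?\<tau> + 1 * \<eta>))\<bar> \<partial>lborel)"
        using nn_integral_real_affine[of "\<lambda>s. ennreal \<bar>F (line l a b x s)\<bar>" 1 ?\<tau>] by simp
      also have "\<dots> \<le> G x"
        unfolding G_def
      proof (intro nn_integral_mono)
        fix \<eta>
        have "F (line l a b x (?\<tau> + \<eta>)) = 0" if "\<eta> \<notin> {-1..1}"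
        proof -
          have "?\<tau> + \<eta> \<notin> {0..1}" using that par_in_cbox[of a l b x, OF ab x] by auto
          then show ?thesis by (simp add: F_def line_in_cbox[of a l b, OF ab x])
        qed
        then show "ennreal \<bar>F (line l a b x (?\<tau> + 1 * \<eta>))\<bar> \<le> indicator {-1..1} \<eta> * ennreal \<bar>F (x + (\<eta> * \<delta>) *\<^sub>R e)\<bar>"
          using line_par_add[of a l b x \<eta>, OF ab] by (cases "\<eta> \<in> {-1..1}") (auto simp: e_def \<delta>_def)
      qed
      finally have "(\<integral>\<^sup>+s. ennreal (norm (indicator {0..1} s * f (line l a b x s))) \<partial>lborel) < \<infinity>"
        using elim by (simp add: less_top top.not_eq_extremum)
      then show "slice_integrable l a b f x" unfolding slice_integrable_def by (intro integrableI_bounded) auto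
    qed
  qed
qed

lemma Lp_le_imp_L1_le:
  fixes f :: "real ^ 'd \<Rightarrow> real"
  assumes p: "1 \<le> p" and F: "Lp_le p (\<lambda>x. indicator (cbox a b) x * f x) B"
  shows "\<exists>B'. Lp_le 1 (\<lambda>x. indicator (cbox a b) x * f x) B'"
proof -
  define F where "F x = indicator (cbox a b) x * f x" for x
  have FB: "Lp_le p F B" using F unfolding F_def .
  have [measurable]: "F \<in> borel_measurable borel" using FB by (simp add: Lp_le_def)
  have F0: "F x = indicator (cbox a b) x * F x" for x by (simp add: F_def indicator_def)
  have "(\<integral>\<^sup>+x. ennreal \<bar>F x\<bar> \<partial>lborel) < \<infinity>"
  proof (cases "p = \<infinity>")
    case True
    have "AE x in lborel. \<bar>F x\<bar> \<le> B" using FB True by (simp add: Lp_le_def)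
    then have "(\<integral>\<^sup>+x. ennreal \<bar>F x\<bar> \<partial>lborel) \<le> (\<integral>\<^sup>+x. ennreal B * indicator (cbox a b) x \<partial>lborel)"
      by (intro nn_integral_mono_AE, eventually_elim) (auto simp: F_def indicator_def ennreal_leI)
    also have "\<dots> < \<infinity>" by (simp add: nn_integral_cmult ennreal_mult_less_top emeasure_lborel_cbox_finite[unfolded infinity_ennreal_def])
    finally show ?thesis .
  next
    case False
    define q where "q = enn2real p"
    have q: "1 \<le> q" unfolding q_def using enn2real_ge_1[OF p False] .
    have "(\<integral>\<^sup>+x. ennreal \<bar>F x\<bar> \<partial>lborel) \<le> (\<integral>\<^sup>+x. indicator (cbox a b) x + ennreal (\<bar>F x\<bar> powr q) \<partial>lborel)"
    proof (intro nn_integral_mono)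
      fix x
      have "\<bar>F x\<bar> \<le> 1 + \<bar>F x\<bar> powr q"
      proof (cases "\<bar>F x\<bar> \<le> 1")
        case True then show ?thesis using powr_ge_zero[of "\<bar>F x\<bar>" q] by linarith
      next
        case False
        then have "\<bar>F x\<bar> powr 1 \<le> \<bar>F x\<bar> powr q" using q by (intro powr_mono) auto
        then show ?thesis using False by simp
      qed
      then have "ennreal \<bar>F x\<bar> \<le> ennreal (1 + \<bar>F x\<bar> powr q)" by (rule ennreal_leI)
      also have "\<dots> = 1 + ennreal (\<bar>F x\<bar> powr q)" by (subst ennreal_plus) auto
      finally show "ennreal \<bar>F x\<bar> \<le> indicator (cbox a b) x + ennreal (\<bar>F x\<bar> powr q)"
        by (cases "x \<in> cbox a b") (auto simp: F_def)
    qed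
    also have "\<dots> = emeasure lborel (cbox a b) + (\<integral>\<^sup>+x. ennreal (\<bar>F x\<bar> powr q) \<partial>lborel)"
      by (subst nn_integral_add) auto
    also have "\<dots> < \<infinity>"
    proof -
      have "(\<integral>\<^sup>+x. ennreal (\<bar>F x\<bar> powr q) \<partial>lborel) \<le> ennreal (B powr q)" using FB False by (simp add: Lp_le_def q_def)
      then have "(\<integral>\<^sup>+x. ennreal (\<bar>F x\<bar> powr q) \<partial>lborel) < \<infinity>" by (rule le_less_trans) simp
      then show ?thesis using emeasure_lborel_cbox_finite[of a b] by (simp add: less_top)
    qed
    finally show ?thesis .
  qed
  then have "Lp_le 1 F (enn2real (\<integral>\<^sup>+x. ennreal \<bar>F x\<bar> \<partial>lborel))"
    by (auto simp: Lp_le_def less_top)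
  then show ?thesis unfolding F_def by blast
qed

lemma Lp_le_unit_average:
  fixes G :: "real \<Rightarrow> real ^ 'd \<Rightarrow> real"
  assumes p: "1 \<le> p" and [measurable]: "(\<lambda>(\<theta>, x). G \<theta> x) \<in> borel_measurable (borel \<Otimes>\<^sub>M borel)"
    and le: "\<And>\<theta>. \<theta> \<in> {0..1} \<Longrightarrow> Lp_le p (G \<theta>) B"
  shows "Lp_le p (\<lambda>x. \<integral>\<theta>. indicator {0..1} \<theta> * \<bar>G \<theta> x\<bar> \<partial>lborel) B"
proof -
  define \<nu> where "\<nu> = density lborel (\<lambda>\<theta>::real. ennreal (indicator {0..1} \<theta>))"
  have B: "0 \<le> B" using Lp_le_nonneg[OF le[of 0]] by simp
  have pr: "prob_space \<nu>"
    by (rule prob_spaceI) (simp add: \<nu>_def emeasure_density ennreal_indicator)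
  have "Lp_le p (\<lambda>x. \<integral>\<theta>. \<bar>indicator {0..1} \<theta> * G \<theta> x\<bar> \<partial>\<nu>) B"
  proof (rule Lp_le_integral[OF pr p])
    have "(\<lambda>(\<theta>, x). indicator {0..1} \<theta> * G \<theta> x) \<in> borel_measurable (borel \<Otimes>\<^sub>M borel)" by measurable
    then show "(\<lambda>(\<theta>, x). indicator {0..1} \<theta> * G \<theta> x) \<in> borel_measurable (\<nu> \<Otimes>\<^sub>M borel)"
      by (simp add: \<nu>_def cong: measurable_cong_sets sets_pair_measure_cong)
    fix \<theta>
    show "Lp_le p (\<lambda>x. indicator {0..1} \<theta> * G \<theta> x) B"
      using le[of \<theta>] Lp_le_zero[OF p B] by (cases "\<theta> \<in> {0..1}") auto
  qed
  moreover have "(\<integral>\<theta>. \<bar>indicator {0..1} \<theta> * G \<theta> x\<bar> \<partial>\<nu>) = (\<integral>\<theta>. indicator {0..1} \<theta> * \<bar>G \<theta> x\<bar> \<partial>lborel)" for x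
  proof -
    have [measurable]: "(\<lambda>\<theta>. G \<theta> x) \<in> borel_measurable borel"
      using measurable_compose[OF measurable_Pair2'[of x borel borel] assms(2)] by simp
    have "(\<integral>\<theta>. \<bar>indicator {0..1} \<theta> * G \<theta> x\<bar> \<partial>\<nu>) = (\<integral>\<theta>. indicator {0..1} \<theta> *\<^sub>R \<bar>indicator {0..1} \<theta> * G \<theta> x\<bar> \<partial>lborel)"
      unfolding \<nu>_def by (rule integral_density) auto
    also have "\<dots> = (\<integral>\<theta>. indicator {0..1} \<theta> * \<bar>G \<theta> x\<bar> \<partial>lborel)"
      by (intro Bochner_Integration.integral_cong) (auto simp: indicator_def)
    finally show ?thesis .
  qed
  ultimately show ?thesis by simp
qed

section \<open>Projection in one direction\<close>

definition cell_int :: "'d \<Rightarrow> real ^ 'd \<Rightarrow> real ^ 'd \<Rightarrow> nat \<Rightarrow> nat \<Rightarrow> (real ^ 'd \<Rightarrow> real) \<Rightarrow> real ^ 'd \<Rightarrow> real" where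
  "cell_int l a b M k f x = (\<integral>s. indicator (cell M k) s * f (line l a b x s) \<partial>lborel)"

text \<open>
  When \<open>q k\<close> are the polynomials dual to the first \<open>r\<close> cell integrals, this operator replaces \<open>f\<close>
  on every edge of direction \<open>l\<close> by the polynomial with the same integrals over these cells.
\<close>

definition dir_proj :: "(nat \<Rightarrow> real poly) \<Rightarrow> nat \<Rightarrow> nat \<Rightarrow> 'd \<Rightarrow> real ^ 'd \<Rightarrow> real ^ 'd \<Rightarrow> (real ^ 'd \<Rightarrow> real) \<Rightarrow> real ^ 'd \<Rightarrow> real" where
  "dir_proj q r M l a b f x = (\<Sum>k<r. poly (q k) (par l a b x) * cell_int l a b M k f x)"

lemma cell_int_line [simp]: "cell_int l a b M k f (line l a b x s) = cell_int l a b M k f x"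
  by (simp add: cell_int_def)

lemma sets_cell [measurable]: "cell M k \<in> sets borel"
  by (simp add: cell_def)

lemma cell_subset_unit: assumes "k < M" shows "cell M k \<subseteq> {0..1}"
proof
  fix s assume s: "s \<in> cell M k"
  have "(real k + 1) / real M \<le> 1" using assms by (simp add: divide_le_eq_1)
  moreover have "0 \<le> real k / real M" by simp
  ultimately show "s \<in> {0..1}" using s unfolding cell_def atLeastLessThan_iff atLeastAtMost_iff by linarith
qed

lemma integrable_cell_slice:
  fixes f :: "real ^ 'd \<Rightarrow> real"
  assumes f: "slice_integrable l a b f x" and k: "k < M"
  shows "integrable lborel (\<lambda>s. indicator (cell M k) s * f (line l a b x s))"
proof -
  have "(\<lambda>s. indicator (cell M k) s * f (line l a b x s)) = (\<lambda>s. indicator (cell M k) s * (indicator {0..1} s * f (line l a b x s)))"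
    using cell_subset_unit[OF k] by (auto simp: indicator_def fun_eq_iff)
  then show ?thesis using integrable_indicator_mult[OF f[unfolded slice_integrable_def] sets_cell] by simp
qed

lemma measurable_cell_int [measurable]:
  assumes [measurable]: "f \<in> borel_measurable borel"
  shows "cell_int l a b M k f \<in> borel_measurable borel"
  unfolding cell_int_def by measurable

lemma measurable_poly [measurable]: "poly q \<in> borel_measurable (borel :: real measure)"
  by (intro borel_measurable_continuous_onI continuous_intros)

lemma measurable_dir_proj [measurable]:
  assumes [measurable]: "f \<in> borel_measurable borel"
  shows "dir_proj q r M l a b f \<in> borel_measurable borel"
  unfolding dir_proj_def by measurable

text \<open>
  On the box, an integral over a cell is at most the integral over the whole edge, which is twice an
  average of translates with displacements between \<open>-\<delta>\<close> and \<open>\<delta>\<close>. This costs a factor \<open>2\<close>, but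
  it is a bound by translations only.
\<close>

lemma Lp_le_cell_int:
  fixes f :: "real ^ 'd \<Rightarrow> real"
  assumes p: "1 \<le> p" and ab: "a $ l < b $ l" and k: "k < M" and [measurable]: "f \<in> borel_measurable borel"
    and F: "Lp_le p (\<lambda>x. indicator (cbox a b) x * f x) B"
  shows "Lp_le p (\<lambda>x. indicator (cbox a b) x * cell_int l a b M k f x) (2 * B)"
proof -
  define F where "F x = indicator (cbox a b) x * f x" for x
  have FB: "Lp_le p F B" using F unfolding F_def .
  have B: "0 \<le> B" using Lp_le_nonneg[OF FB] .
  have [measurable]: "F \<in> borel_measurable borel" unfolding F_def by measurable
  define e :: "real ^ 'd" where "e = axis l 1"
  define \<delta> where "\<delta> = b $ l - a $ l"
  define A where "A x = (\<integral>\<theta>. indicator {0..1} \<theta> * \<bar>F (x + ((2 * \<theta> - 1) * \<delta>) *\<^sub>R e)\<bar> \<partial>lborel)" for x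
  have "Lp_le p A B"
    unfolding A_def by (rule Lp_le_unit_average[OF p]) (measurable, rule Lp_le_translate[OF FB])
  then have A2: "Lp_le p (\<lambda>x. 2 * A x) (2 * B)" using Lp_le_cmult[of p A B 2] by simp
  obtain B' where "Lp_le 1 (\<lambda>x. indicator (cbox a b) x * f x) B'" using Lp_le_imp_L1_le[OF p F] by blast
  from AE_slice_integrable[of a l b, OF ab this]
  have "AE x in lborel. x \<in> cbox a b \<longrightarrow> slice_integrable l a b f x" by simp
  then have "AE x in lborel. \<bar>indicator (cbox a b) x * cell_int l a b M k f x\<bar> \<le> \<bar>2 * A x\<bar>"
  proof eventually_elim
    case (elim x)
    show ?case
    proof (cases "x \<in> cbox a b")
      case True
      let ?\<tau> = "par l a b x"
      note lc = line_in_cbox[of a l b, OF ab True]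
      have int: "integrable lborel (\<lambda>s. F (line l a b x s))"
        using elim True unfolding slice_integrable_def
        by (rule_tac Bochner_Integration.integrable_cong[THEN iffD1, rotated 2]) (auto simp: F_def indicator_def lc)
      have "\<bar>cell_int l a b M k f x\<bar> \<le> (\<integral>s. \<bar>indicator (cell M k) s * f (line l a b x s)\<bar> \<partial>lborel)"
        unfolding cell_int_def by (rule integral_abs_bound)
      also have "\<dots> \<le> (\<integral>s. \<bar>F (line l a b x s)\<bar> \<partial>lborel)"
      proof (intro integral_mono')
        show "integrable lborel (\<lambda>s. \<bar>F (line l a b x s)\<bar>)" using int by simp
        show "\<bar>indicator (cell M k) s * f (line l a b x s)\<bar> \<le> \<bar>F (line l a b x s)\<bar>" for s
          using cell_subset_unit[OF k] by (auto simp: indicator_def F_def lc)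
      qed auto
      also have "\<dots> = \<bar>2\<bar> *\<^sub>R (\<integral>\<theta>. \<bar>F (line l a b x ((?\<tau> - 1) + 2 * \<theta>))\<bar> \<partial>lborel)"
        by (rule lborel_integral_real_affine) simp
      also have "(\<integral>\<theta>. \<bar>F (line l a b x ((?\<tau> - 1) + 2 * \<theta>))\<bar> \<partial>lborel) = A x"
        unfolding A_def
      proof (intro Bochner_Integration.integral_cong refl)
        fix \<theta> :: real
        have eq: "(?\<tau> - 1) + 2 * \<theta> = ?\<tau> + (2 * \<theta> - 1)" by simp
        have "F (line l a b x (?\<tau> + (2 * \<theta> - 1))) = 0" if "\<theta> \<notin> {0..1}"
        proof -
          have "?\<tau> + (2 * \<theta> - 1) \<notin> {0..1}" using that par_in_cbox[of a l b x, OF ab True] by auto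
          then show ?thesis by (simp add: F_def lc)
        qed
        then show "\<bar>F (line l a b x ((?\<tau> - 1) + 2 * \<theta>))\<bar> = indicator {0..1} \<theta> * \<bar>F (x + ((2 * \<theta> - 1) * \<delta>) *\<^sub>R e)\<bar>"
          unfolding eq using line_par_add[of a l b x "2 * \<theta> - 1", OF ab]
          by (cases "\<theta> \<in> {0..1}") (auto simp: e_def \<delta>_def)
      qed
      finally show ?thesis using True by simp
    qed simp
  qed
  then show ?thesis by (rule Lp_le_AE_mono[OF A2, rotated]) auto
qed

lemma Lp_le_dir_proj:
  fixes f :: "real ^ 'd \<Rightarrow> real"
  assumes p: "1 \<le> p" and ab: "a $ l < b $ l" and r: "r \<le> M" and [measurable]: "f \<in> borel_measurable borel"
    and F: "Lp_le p (\<lambda>x. indicator (cbox a b) x * f x) B"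
    and \<kappa>: "\<And>k t. k < r \<Longrightarrow> t \<in> {0..1} \<Longrightarrow> \<bar>poly (q k) t\<bar> \<le> \<kappa>" "0 \<le> \<kappa>"
  shows "Lp_le p (\<lambda>x. indicator (cbox a b) x * dir_proj q r M l a b f x) (2 * \<kappa> * real r * B)"
proof -
  have "Lp_le p (\<lambda>x. \<Sum>k<r. \<bar>\<kappa> * (indicator (cbox a b) x * cell_int l a b M k f x)\<bar>) (\<Sum>k<r. \<bar>\<kappa>\<bar> * (2 * B))"
    using r by (intro Lp_le_sum[OF p] Lp_le_cmult Lp_le_cell_int p ab F) auto
  then show ?thesis
  proof (rule Lp_le_mono)
    fix x
    have "\<bar>indicator (cbox a b) x * dir_proj q r M l a b f x\<bar> \<le> (\<Sum>k<r. \<bar>\<kappa> * (indicator (cbox a b) x * cell_int l a b M k f x)\<bar>)"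
    proof (cases "x \<in> cbox a b")
      case True
      have "\<bar>dir_proj q r M l a b f x\<bar> \<le> (\<Sum>k<r. \<bar>poly (q k) (par l a b x) * cell_int l a b M k f x\<bar>)"
        unfolding dir_proj_def by (rule sum_abs)
      also have "\<dots> \<le> (\<Sum>k<r. \<bar>\<kappa> * cell_int l a b M k f x\<bar>)"
        unfolding abs_mult using \<kappa> par_in_cbox[of a l b x, OF ab True] by (intro sum_mono mult_right_mono) auto
      finally show ?thesis using True by simp
    qed (simp add: sum_nonneg)
    then show "\<bar>indicator (cbox a b) x * dir_proj q r M l a b f x\<bar> \<le> \<bar>\<Sum>k<r. \<bar>\<kappa> * (indicator (cbox a b) x * cell_int l a b M k f x)\<bar>\<bar>"
      by linarith
  qed (use \<kappa> in \<open>auto simp: mult_ac\<close>)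
qed

section \<open>Whitney's inequality in one direction\<close>

lemma partial_fdiff_eq_sum:
  "partial_fdiff i m \<eta> f x = (\<Sum>j\<le>m. (-1) ^ (m - j) * real (m choose j) * f (x + (real j * \<eta>) *\<^sub>R axis i 1))"
proof -
  have "(\<chi> k. if k = i then x $ i + c else x $ k) = x + c *\<^sub>R axis i 1" for c
    by (auto simp: vec_eq_iff axis_def)
  then show ?thesis by (simp add: partial_fdiff_def fdiff_def)
qed

lemma partial_fdiff_eq_line:
  assumes "a $ l < b $ l"
  shows "partial_fdiff l m ((b $ l - a $ l) * h) f x = fdiff m h (\<lambda>s. f (line l a b x s)) (par l a b x)"
  unfolding partial_fdiff_eq_sum fdiff_def line_par_add[of a l b, OF assms] by (simp add: mult_ac)

lemma measurable_partial_fdiff [measurable]: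
  assumes [measurable]: "f \<in> borel_measurable borel"
  shows "partial_fdiff i m \<eta> f \<in> borel_measurable borel"
  unfolding partial_fdiff_eq_sum[abs_def] by measurable

text \<open>
  For fixed \<open>\<eta>\<close>, the function whose norm enters the modulus of smoothness in direction \<open>l\<close>, extended
  by zero to the whole space.
\<close>

definition dir_diff :: "'d \<Rightarrow> real ^ 'd \<Rightarrow> real ^ 'd \<Rightarrow> nat \<Rightarrow> real \<Rightarrow> (real ^ 'd \<Rightarrow> real) \<Rightarrow> real ^ 'd \<Rightarrow> real" where
  "dir_diff l a b r \<eta> f x = indicator (cbox a b) x * indicator (cbox a b) (x + (real r * \<eta>) *\<^sub>R axis l 1) * partial_fdiff l r \<eta> f x"

lemma fdiff_cong_unit:
  assumes r: "1 \<le> r" and t: "0 \<le> t" "t \<le> 1" "0 \<le> t + real r * h" "t + real r * h \<le> 1"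
    and eq: "\<And>s. 0 \<le> s \<Longrightarrow> s \<le> 1 \<Longrightarrow> f s = g s"
  shows "fdiff r h f t = fdiff r h g t"
proof (rule fdiff_cong)
  fix j assume "j \<le> r"
  define \<mu> where "\<mu> = real j / real r"
  have \<mu>: "0 \<le> \<mu>" "\<mu> \<le> 1" using \<open>j \<le> r\<close> r by (auto simp: \<mu>_def divide_le_eq_1)
  have e: "t + real j * h = (1 - \<mu>) * t + \<mu> * (t + real r * h)" using r by (simp add: \<mu>_def algebra_simps)
  have "0 \<le> (1 - \<mu>) * t + \<mu> * (t + real r * h)" using \<mu> t by simp
  moreover have "(1 - \<mu>) * t + \<mu> * (t + real r * h) \<le> 1" using \<mu> t by (intro convex_bound_le) auto
  ultimately show "f (t + real j * h) = g (t + real j * h)" unfolding e by (intro eq)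
qed

text \<open>
  A bound that contains half of the unknown norm can be solved for the norm, which must be known
  to be finite in advance. The least bound exists since the norm itself is one.
\<close>

lemma Lp_le_absorb:
  assumes p: "1 \<le> p" and fin: "Lp_le p u B0" and W: "0 \<le> W"
    and step: "\<And>B. Lp_le p u B \<Longrightarrow> Lp_le p u (W + B / 2)"
  shows "Lp_le p u (2 * W)"
proof -
  have [measurable]: "u \<in> borel_measurable borel" using fin by (simp add: Lp_le_def)
  have iff: "Lp_norm p UNIV u \<le> ennreal B \<longleftrightarrow> Lp_le p u B" if "0 \<le> B" for B
    using Lp_norm_le_iff[OF p _ _ _ that, of UNIV u u] by simp
  have "Lp_norm p UNIV u \<le> ennreal B0" using iff fin Lp_le_nonneg[OF fin] by simp
  then obtain N where N: "Lp_norm p UNIV u = ennreal N" "0 \<le> N" by (cases "Lp_norm p UNIV u") (auto simp: top_unique)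
  have "Lp_le p u (W + N / 2)" using iff[of N] N step by simp
  then have "ennreal N \<le> ennreal (W + N / 2)" using iff[of "W + N / 2"] N W by simp
  then have "N \<le> 2 * W" using N W by (subst (asm) ennreal_le_iff) auto
  then have "Lp_norm p UNIV u \<le> ennreal (2 * W)" using N by (simp add: ennreal_leI)
  then show ?thesis using iff[of "2 * W"] W by simp
qed

lemma dir_diff_average:
  fixes f :: "real ^ 'd \<Rightarrow> real"
  assumes p: "1 \<le> p" and [measurable]: "f \<in> borel_measurable borel"
    and W: "\<And>\<theta>. \<theta> \<in> {0..1} \<Longrightarrow> Lp_le p (dir_diff l a b r (c * \<theta>) f) W"
  shows "Lp_le p (\<lambda>x. \<integral>\<theta>. indicator {0..1} \<theta> * \<bar>dir_diff l a b r (c * \<theta>) f x\<bar> \<partial>lborel) W"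
proof (rule Lp_le_unit_average[OF p _ W])
  show "(\<lambda>(\<theta>, x). dir_diff l a b r (c * \<theta>) f x) \<in> borel_measurable (borel \<Otimes>\<^sub>M borel)"
    unfolding dir_diff_def partial_fdiff_eq_sum by measurable
qed

text \<open>
  Whitney's inequality in one direction. The univariate bound is applied to the error on almost
  every edge, with \<open>\<sigma> = 1\<close> on the lower half of the box and \<open>\<sigma> = -1\<close> on the upper half. For the
  norms this gives \<open>\<parallel>u\<parallel> \<le> 2 (1 + K) W + \<parallel>u\<parallel> / 2\<close>, and the last term is absorbed.
\<close>

lemma Lp_le_dir_proj_error:
  fixes f :: "real ^ 'd \<Rightarrow> real" and q :: "nat \<Rightarrow> real poly"
  assumes p: "1 \<le> p" and ab: "a $ l < b $ l" and r: "1 \<le> r" and M: "M = 16 * r * 2 ^ r"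
    and q: "\<And>k. k < r \<Longrightarrow> q k = 0 \<or> degree (q k) < r"
      "\<And>k c. k < r \<Longrightarrow> c < r \<Longrightarrow> (\<integral>s. indicator (cell M c) s * poly (q k) s \<partial>lborel) = (if c = k then 1 else 0)"
    and f[measurable]: "f \<in> borel_measurable borel"
    and fB: "Lp_le p (\<lambda>x. indicator (cbox a b) x * f x) B"
    and PB: "Lp_le p (\<lambda>x. indicator (cbox a b) x * dir_proj q r M l a b f x) B'"
    and W: "\<And>\<eta>. \<bar>\<eta>\<bar> \<le> b $ l - a $ l \<Longrightarrow> Lp_le p (dir_diff l a b r \<eta> f) W"
  shows "Lp_le p (\<lambda>x. indicator (cbox a b) x * (f x - dir_proj q r M l a b f x))
     (4 * (1 + 8 * real r * 2 ^ r * real M * (1 + 2 ^ r) ^ M) * W)"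
proof -
  define Q where "Q = cbox a b"
  define \<delta> where "\<delta> = b $ l - a $ l"
  define e :: "real ^ 'd" where "e = axis l 1"
  have \<delta>: "\<delta> > 0" using ab by (simp add: \<delta>_def)
  have [measurable]: "Q \<in> sets borel" by (simp add: Q_def)
  define P where "P = dir_proj q r M l a b f"
  have [measurable]: "P \<in> borel_measurable borel" unfolding P_def by measurable
  define u where "u x = indicator Q x * (f x - P x)" for x
  have [measurable]: "u \<in> borel_measurable borel" unfolding u_def by measurable
  have M0: "0 < M" and rM: "r \<le> M" using r by (auto simp: M intro: order.trans[of r "r * 1"] mult_le_mono)
  have W0: "0 \<le> W" using W[of 0] ab Lp_le_nonneg by auto
  define K where "K = 8 * real r * 2 ^ r * real M * (1 + 2 ^ r) ^ M"
  have K0: "0 \<le> K" by (simp add: K_def)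
  have uB: "Lp_le p u (B + B')"
    by (rule Lp_le_mono[OF Lp_le_add[OF p fB PB]]) (auto simp: u_def Q_def P_def indicator_def)
  obtain B1 where "Lp_le 1 (\<lambda>x. indicator (cbox a b) x * f x) B1" using Lp_le_imp_L1_le[OF p fB] by blast
  from AE_slice_integrable[of a l b, OF ab this]
  have sl: "AE x in lborel. x \<in> cbox a b \<longrightarrow> slice_integrable l a b f x" by simp
  define A1 where "A1 c x = (\<integral>\<theta>. indicator {0..1} \<theta> * \<bar>dir_diff l a b r (c * \<theta>) f x\<bar> \<partial>lborel)" for c x
  define A2 where "A2 x = (\<integral>\<theta>. indicator {0..1} \<theta> * \<bar>dir_diff l a b r (\<delta> / real M) f (x + ((2 * \<theta> - 1) * \<delta>) *\<^sub>R e)\<bar> \<partial>lborel)" for x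
  define A3 where "A3 c x = (\<integral>\<theta>. indicator {0..1} \<theta> * \<bar>u (x + ((c - \<theta> / real M) * \<delta>) *\<^sub>R e)\<bar> \<partial>lborel)" for c x
  have A1: "Lp_le p (A1 c) W" if "\<bar>c\<bar> \<le> \<delta>" for c
    unfolding A1_def
  proof (rule dir_diff_average[OF p f W])
    fix \<theta> :: real assume "\<theta> \<in> {0..1}"
    then have "\<bar>c\<bar> * \<bar>\<theta>\<bar> \<le> \<delta> * 1" using that \<delta> by (intro mult_mono) auto
    then show "\<bar>c * \<theta>\<bar> \<le> b $ l - a $ l" by (simp add: abs_mult \<delta>_def)
  qed
  have [measurable]: "dir_diff l a b r \<eta> f \<in> borel_measurable borel" for \<eta>
    unfolding dir_diff_def by measurable
  have "\<delta> * 1 \<le> \<delta> * real M" using M0 \<delta> by (intro mult_left_mono) auto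
  then have dM: "\<delta> / real M \<le> \<delta>" using M0 by (simp add: divide_le_eq)
  have A2: "Lp_le p A2 W"
    unfolding A2_def
    by (rule Lp_le_unit_average[OF p]) (measurable, intro Lp_le_translate W, use dM \<delta> in \<open>simp add: \<delta>_def\<close>)
  have A3: "Lp_le p (A3 c) B" if "Lp_le p u B" for c B
    unfolding A3_def
    by (rule Lp_le_unit_average[OF p]) (measurable, intro Lp_le_translate that)
  have pw: "AE x in lborel. x \<in> Q \<longrightarrow> 0 \<le> par l a b x + \<sigma> / 2 \<longrightarrow> par l a b x + \<sigma> / 2 \<le> 1 \<longrightarrow>
       \<bar>u x\<bar> \<le> A1 (\<delta> * (\<sigma> / (2 * real r))) x + K * A2 x
       + 2 * real r / real M * (\<Sum>j\<le>r. real (r choose j) * (A3 (real j * (\<sigma> / (2 * real r))) x + A3 0 x))"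
    if \<sigma>: "\<bar>\<sigma>\<bar> = 1" for \<sigma>
    using sl
  proof eventually_elim
    case (elim x)
    show ?case
    proof (intro impI)
      assume xQ: "x \<in> Q" and \<tau>\<sigma>: "0 \<le> par l a b x + \<sigma> / 2" "par l a b x + \<sigma> / 2 \<le> 1"
      define \<tau> where "\<tau> = par l a b x"
      have x: "x \<in> cbox a b" using xQ by (simp add: Q_def)
      note lc = line_in_cbox[of a l b, OF ab x]
      have \<tau>: "0 \<le> \<tau>" "\<tau> \<le> 1" using par_in_cbox[of a l b x, OF ab x] by (auto simp: \<tau>_def)
      define g where "g s = f (line l a b x s)" for s
      define \<pi> where "\<pi> = (\<Sum>k<r. smult (cell_int l a b M k f x) (q k))"
      \<comment> \<open>On this edge the operator yields the fixed polynomial \<open>\<pi>\<close>, which differences of order \<open>r\<close> cannot see.\<close>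
      have d\<pi>: "degree \<pi> < r"
      proof -
        have "degree \<pi> \<le> r - 1" unfolding \<pi>_def
          by (intro degree_sum_le) (use q(1) in \<open>force intro: order.trans[OF degree_smult_le]\<close>)+
        then show ?thesis using r by linarith
      qed
      have P: "P (line l a b x s) = poly \<pi> s" for s
        using ab by (simp add: P_def dir_proj_def \<pi>_def poly_sum mult.commute)
      define v where "v s = u (line l a b x s)" for s
      have v: "v s = indicator {0..1} s * g s - indicator {0..1} s * poly \<pi> s" for s
        unfolding v_def u_def P Q_def by (auto simp: indicator_def lc g_def)
      have ig: "integrable lborel (\<lambda>s. indicator {0..1} s * g s)"
        using elim x by (simp add: slice_integrable_def g_def)
      have icell: "integrable lborel (\<lambda>s. indicator (cell M c) s * g s)" if "c < M" for c
        unfolding g_def by (rule integrable_cell_slice[OF _ that]) (use elim x in blast)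
      have ip: "integrable lborel (\<lambda>s. indicator {0..1} s * poly \<pi> s)"
      proof -
        have "integrable lborel (\<lambda>s. indicator {0..1} s *\<^sub>R poly \<pi> s)"
          by (intro borel_integrable_compact continuous_intros) auto
        then show ?thesis by simp
      qed
      have iv: "integrable lborel v" unfolding v[abs_def] using ig ip by simp
      have zero: "(\<integral>s. indicator (cell M c) s * v s \<partial>lborel) = 0" if c: "c < r" for c
      proof -
        have cM: "c < M" using c rM by simp
        have "(\<integral>s. indicator (cell M c) s * v s \<partial>lborel) = (\<integral>s. indicator (cell M c) s * g s - (\<Sum>k<r. cell_int l a b M k f x * (indicator (cell M c) s * poly (q k) s)) \<partial>lborel)"
          using cell_subset_unit[OF cM]
          by (intro Bochner_Integration.integral_cong) (auto simp: v indicator_def \<pi>_def poly_sum)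
        also have "\<dots> = (\<integral>s. indicator (cell M c) s * g s \<partial>lborel) - (\<Sum>k<r. cell_int l a b M k f x * (\<integral>s. indicator (cell M c) s * poly (q k) s \<partial>lborel))"
          using icell[OF cM] integrable_poly_atLeastLessThan
          by (subst Bochner_Integration.integral_diff) (auto simp: cell_def intro!: Bochner_Integration.integrable_sum integrable_mult_right)
        also have "\<dots> = cell_int l a b M c f x - (\<Sum>k<r. cell_int l a b M k f x * (if c = k then 1 else 0))"
          using q(2) c unfolding g_def cell_int_def[symmetric] by (intro arg_cong2[where f = minus] sum.cong) auto
        also have "(\<Sum>k<r. cell_int l a b M k f x * (if c = k then 1 else 0)) = (\<Sum>k<r. if c = k then cell_int l a b M k f x else 0)"
          by (intro sum.cong) auto
        also have "cell_int l a b M c f x - \<dots> = 0" using c by simp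
        finally show ?thesis .
      qed
      define h where "h = \<sigma> / (2 * real r)"
      have fd: "fdiff r \<eta> v t = fdiff r \<eta> g t" if "0 \<le> t" "t \<le> 1" "0 \<le> t + real r * \<eta>" "t + real r * \<eta> \<le> 1" for \<eta> t
      proof -
        have "fdiff r \<eta> v t = fdiff r \<eta> (\<lambda>s. g s - poly \<pi> s) t"
          by (rule fdiff_cong_unit[OF r that]) (simp add: v)
        then show ?thesis using fdiff_poly_eq_0[OF d\<pi>] by (simp add: fdiff_diff)
      qed
      have par_add: "par l a b (line l a b x s) = s" for s using ab by simp
      have dd: "dir_diff l a b r (\<delta> * \<eta>) f (line l a b x t)
          = (if 0 \<le> t \<and> t \<le> 1 \<and> 0 \<le> t + real r * \<eta> \<and> t + real r * \<eta> \<le> 1 then fdiff r \<eta> v t else 0)" for \<eta> t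
      proof -
        have "line l a b x t + (real r * (\<delta> * \<eta>)) *\<^sub>R axis l 1 = line l a b x (t + real r * \<eta>)"
          using line_par_add[of a l b "line l a b x t" "real r * \<eta>", OF ab] par_add by (simp add: \<delta>_def mult_ac)
        then have "dir_diff l a b r (\<delta> * \<eta>) f (line l a b x t)
           = indicator {0..1} t * indicator {0..1} (t + real r * \<eta>) * fdiff r \<eta> g t"
          unfolding dir_diff_def \<delta>_def partial_fdiff_eq_line[of a l b, OF ab] par_add
          by (simp add: indicator_def lc g_def[abs_def])
        then show ?thesis using fd by (auto simp: indicator_def)
      qed
      have xl: "line l a b x \<tau> = x" "\<And>\<eta>. line l a b x (\<tau> + \<eta>) = x + (\<eta> * \<delta>) *\<^sub>R e"
        using line_par_add[of a l b x, OF ab] line_par[of a l b x, OF ab] by (auto simp: \<tau>_def \<delta>_def e_def)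
      have vt: "v \<tau> = u x" "\<And>\<eta>. v (\<tau> + \<eta>) = u (x + (\<eta> * \<delta>) *\<^sub>R e)" by (auto simp: v_def xl)
      have T1: "(\<integral>\<theta>. indicator {0..1} \<theta> * \<bar>fdiff r (h * \<theta>) v \<tau>\<bar> \<partial>lborel) = A1 (\<delta> * h) x"
        unfolding A1_def
      proof (intro Bochner_Integration.integral_cong refl)
        fix \<theta> :: real
        have "0 \<le> \<tau> + real r * (h * \<theta>) \<and> \<tau> + real r * (h * \<theta>) \<le> 1" if "\<theta> \<in> {0..1}"
        proof -
          have e': "\<tau> + real r * (h * \<theta>) = (1 - \<theta>) * \<tau> + \<theta> * (\<tau> + \<sigma> / 2)" using r by (simp add: h_def algebra_simps)
          have "0 \<le> (1 - \<theta>) * \<tau> + \<theta> * (\<tau> + \<sigma> / 2)" using that \<tau> \<tau>\<sigma> by (simp add: \<tau>_def)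
          moreover have "(1 - \<theta>) * \<tau> + \<theta> * (\<tau> + \<sigma> / 2) \<le> 1" using that \<tau> \<tau>\<sigma> by (intro convex_bound_le) (auto simp: \<tau>_def)
          ultimately show ?thesis unfolding e' by simp
        qed
        then show "indicator {0..1} \<theta> * \<bar>fdiff r (h * \<theta>) v \<tau>\<bar> = indicator {0..1} \<theta> * \<bar>dir_diff l a b r (\<delta> * h * \<theta>) f x\<bar>"
          using dd[of "h * \<theta>" \<tau>] \<tau> by (auto simp: xl mult.assoc indicator_def)
      qed
      have T2: "(\<integral>\<theta>. indicator {0..1} \<theta> * \<bar>indicator {0..1 - real r / real M} (\<tau> + (2 * \<theta> - 1)) * fdiff r (1 / real M) v (\<tau> + (2 * \<theta> - 1))\<bar> \<partial>lborel) = A2 x"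
        unfolding A2_def
      proof (intro Bochner_Integration.integral_cong refl)
        fix \<theta> :: real
        have "(0 \<le> t \<and> t \<le> 1 \<and> 0 \<le> t + real r * (1 / real M) \<and> t + real r * (1 / real M) \<le> 1) \<longleftrightarrow> t \<in> {0..1 - real r / real M}" for t
        proof -
          have "(0 \<le> t \<and> t \<le> 1 \<and> 0 \<le> t + c \<and> t + c \<le> 1) \<longleftrightarrow> t \<in> {0..1 - c}" if "0 \<le> c" for c
            using that by auto
          from this[of "real r * (1 / real M)"] show ?thesis by simp
        qed
        then have "indicator {0..1 - real r / real M} t * fdiff r (1 / real M) v t = dir_diff l a b r (\<delta> / real M) f (line l a b x t)" for t
          using dd[of "1 / real M" t] by (simp add: indicator_def)
        then show "indicator {0..1} \<theta> * \<bar>indicator {0..1 - real r / real M} (\<tau> + (2 * \<theta> - 1)) * fdiff r (1 / real M) v (\<tau> + (2 * \<theta> - 1))\<bar>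
          = indicator {0..1} \<theta> * \<bar>dir_diff l a b r (\<delta> / real M) f (x + ((2 * \<theta> - 1) * \<delta>) *\<^sub>R e)\<bar>"
          by (simp only: xl)
      qed
      have T3: "(\<integral>\<theta>. indicator {0..1} \<theta> * \<bar>v (\<tau> + (c - \<theta> / real M))\<bar> \<partial>lborel) = A3 c x" for c
        unfolding A3_def by (simp only: vt)
      have T4: "(\<integral>\<theta>. indicator {0..1} \<theta> * \<bar>v (\<tau> + (- \<theta> / real M))\<bar> \<partial>lborel) = A3 0 x"
        using T3[of 0] by simp
      show "\<bar>u x\<bar> \<le> A1 (\<delta> * (\<sigma> / (2 * real r))) x + K * A2 x
       + 2 * real r / real M * (\<Sum>j\<le>r. real (r choose j) * (A3 (real j * (\<sigma> / (2 * real r))) x + A3 0 x))"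
        using pointwise_bound[OF iv r M0 \<sigma> \<tau> \<tau>\<sigma>[folded \<tau>_def] zero]
        unfolding h_def[symmetric] T1 T2 T3 T4 unfolding vt(1) K_def by simp
    qed
  qed
  have half: "Lp_le p (\<lambda>x. if 0 \<le> par l a b x + \<sigma> / 2 \<and> par l a b x + \<sigma> / 2 \<le> 1 then u x else 0) ((1 + K) * W + B / 4)"
    if \<sigma>: "\<bar>\<sigma>\<bar> = 1" and uB: "Lp_le p u B" for \<sigma> B
  proof -
    have B: "0 \<le> B" using Lp_le_nonneg[OF uB] .
    have sumc: "(\<Sum>j\<le>r. real (r choose j)) = 2 ^ r" by (rule sum_binomials)
    let ?h = "\<sigma> / (2 * real r)"
    let ?c = "2 * real r / real M"
    have "\<bar>\<delta> * ?h\<bar> \<le> \<delta> * 1" unfolding abs_mult using \<delta> \<sigma> r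
      by (intro mult_mono) (auto simp: abs_divide divide_le_eq_1)
    then have a1: "Lp_le p (A1 (\<delta> * ?h)) W" by (intro A1) simp
    have a2: "Lp_le p (\<lambda>x. K * A2 x) (K * W)" using Lp_le_cmult[OF A2, of K] K0 by simp
    have nn: "0 \<le> A1 c x" "0 \<le> A2 x" "0 \<le> A3 c x" for c x
      unfolding A1_def A2_def A3_def by (auto intro!: Bochner_Integration.integral_nonneg)
    have "Lp_le p (\<lambda>x. \<Sum>j\<le>r. \<bar>real (r choose j) * (\<bar>A3 (real j * ?h) x\<bar> + \<bar>A3 0 x\<bar>)\<bar>) (\<Sum>j\<le>r. \<bar>real (r choose j)\<bar> * (B + B))"
      by (intro Lp_le_sum[OF p] Lp_le_cmult Lp_le_add[OF p] A3 uB) simp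
    also have "(\<Sum>j\<le>r. \<bar>real (r choose j)\<bar> * (B + B)) = 2 ^ r * (B + B)" by (simp add: sum_distrib_right[symmetric] sumc)
    finally have a3: "Lp_le p (\<lambda>x. ?c * (\<Sum>j\<le>r. real (r choose j) * (A3 (real j * ?h) x + A3 0 x))) (?c * (2 ^ r * (B + B)))"
      using nn by (drule_tac Lp_le_cmult[where c = ?c]) simp
    \<comment> \<open>This is where the number of cells \<open>M = 16 r 2 ^ r\<close> comes from.\<close>
    have c: "?c * (2 ^ r * (B + B)) = B / 4" using r by (simp add: M field_simps)
    have "Lp_le p (\<lambda>x. \<bar>\<bar>A1 (\<delta> * ?h) x\<bar> + \<bar>K * A2 x\<bar>\<bar> + \<bar>?c * (\<Sum>j\<le>r. real (r choose j) * (A3 (real j * ?h) x + A3 0 x))\<bar>) (W + K * W + B / 4)"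
      using a3 unfolding c by (intro Lp_le_add[OF p] a1 a2)
    then show ?thesis
    proof (rule Lp_le_AE_mono)
      show "AE x in lborel. \<bar>if 0 \<le> par l a b x + \<sigma> / 2 \<and> par l a b x + \<sigma> / 2 \<le> 1 then u x else 0\<bar>
        \<le> \<bar>\<bar>\<bar>A1 (\<delta> * ?h) x\<bar> + \<bar>K * A2 x\<bar>\<bar> + \<bar>?c * (\<Sum>j\<le>r. real (r choose j) * (A3 (real j * ?h) x + A3 0 x))\<bar>\<bar>"
        using pw[OF \<sigma>]
      proof eventually_elim
        case (elim x)
        show ?case
        proof (cases "x \<in> Q \<and> 0 \<le> par l a b x + \<sigma> / 2 \<and> par l a b x + \<sigma> / 2 \<le> 1")
          case True
          then have "\<bar>u x\<bar> \<le> A1 (\<delta> * ?h) x + K * A2 x + ?c * (\<Sum>j\<le>r. real (r choose j) * (A3 (real j * ?h) x + A3 0 x))"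
            using elim by blast
          then show ?thesis using True by (simp only: if_True simp_thms)
        qed (auto simp: u_def)
      qed
    qed (measurable, simp add: algebra_simps)
  qed
  have "Lp_le p u (2 * ((2 * (1 + K)) * W))"
  proof (rule Lp_le_absorb[OF p uB])
    fix B assume "Lp_le p u B"
    from Lp_le_add[OF p half[OF _ this, of 1] half[OF _ this, of "-1"]]
    have "Lp_le p (\<lambda>x. \<bar>if 0 \<le> par l a b x + 1 / 2 \<and> par l a b x + 1 / 2 \<le> 1 then u x else 0\<bar> +
          \<bar>if 0 \<le> par l a b x + - 1 / 2 \<and> par l a b x + - 1 / 2 \<le> 1 then u x else 0\<bar>) ((1 + K) * W + B / 4 + ((1 + K) * W + B / 4))" by simp
    then show "Lp_le p u (2 * (1 + K) * W + B / 2)"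
    proof (rule Lp_le_mono)
      fix x
      show "\<bar>u x\<bar> \<le> \<bar>\<bar>if 0 \<le> par l a b x + 1 / 2 \<and> par l a b x + 1 / 2 \<le> 1 then u x else 0\<bar> +
          \<bar>if 0 \<le> par l a b x + - 1 / 2 \<and> par l a b x + - 1 / 2 \<le> 1 then u x else 0\<bar>\<bar>"
        using par_in_cbox[of a l b x, OF ab] by (cases "x \<in> Q") (auto simp: u_def Q_def)
    qed (auto simp: algebra_simps)
  qed (use K0 W0 in simp)
  then show ?thesis by (simp add: u_def[abs_def] Q_def P_def K_def mult_ac)
qed

text \<open>
  The operator and the constant depend on \<open>r\<close> only. Besides the error estimate the boundedness of
  the operator is recorded, since it is needed to compose the operators of different directions.
\<close>

lemma directional_Whitney:
  assumes r: "1 \<le> (r :: nat)"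
  obtains M C and q :: "nat \<Rightarrow> real poly" where "0 < C" "r \<le> M" "\<And>k. k < r \<Longrightarrow> degree (q k) < r"
    "\<And>p a b l f B. 1 \<le> p \<Longrightarrow> a $ l < b $ l \<Longrightarrow> f \<in> borel_measurable borel \<Longrightarrow>
        Lp_le p (\<lambda>x :: real ^ 'd. indicator (cbox a b) x * f x) B \<Longrightarrow>
        Lp_le p (\<lambda>x. indicator (cbox a b) x * dir_proj q r M l a b f x) (C * B)"
    "\<And>p a b l f B W. 1 \<le> p \<Longrightarrow> a $ l < b $ l \<Longrightarrow> f \<in> borel_measurable borel \<Longrightarrow>
        Lp_le p (\<lambda>x :: real ^ 'd. indicator (cbox a b) x * f x) B \<Longrightarrow>
        (\<And>\<eta>. \<bar>\<eta>\<bar> \<le> b $ l - a $ l \<Longrightarrow> Lp_le p (dir_diff l a b r \<eta> f) W) \<Longrightarrow>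
        Lp_le p (\<lambda>x. indicator (cbox a b) x * (f x - dir_proj q r M l a b f x)) (C * W)"
proof -
  define M where "M = 16 * r * 2 ^ r"
  have M0: "0 < M" and rM: "r \<le> M" using r by (auto simp: M_def intro: order.trans[of r "r * 1"] mult_le_mono)
  have "\<exists>q :: real poly. (q = 0 \<or> degree q < r) \<and> (\<forall>c<r. (\<integral>s. indicator (cell M c) s * poly q s \<partial>lborel) = (if c = k then 1 else 0))" for k
    by (rule cell_interpolation[OF M0])
  then obtain q :: "nat \<Rightarrow> real poly" where q: "\<And>k. q k = 0 \<or> degree (q k) < r"
    "\<And>k c. c < r \<Longrightarrow> (\<integral>s. indicator (cell M c) s * poly (q k) s \<partial>lborel) = (if c = k then 1 else 0)"
    by metis
  have "\<exists>\<kappa>. \<forall>t\<in>{0..1}. \<bar>poly (q k) t\<bar> \<le> \<kappa>" for k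
  proof -
    have "bounded (poly (q k) ` {0..1})"
      by (intro compact_imp_bounded compact_continuous_image continuous_intros) auto
    then show ?thesis by (auto simp: bounded_iff)
  qed
  then obtain \<kappa>0 where \<kappa>0: "\<And>k t. t \<in> {0..1} \<Longrightarrow> \<bar>poly (q k) t\<bar> \<le> \<kappa>0 k" by metis
  \<comment> \<open>a common bound on the unit interval for the finitely many dual polynomials\<close>
  define \<kappa> where "\<kappa> = (\<Sum>k<r. \<bar>\<kappa>0 k\<bar>)"
  have \<kappa>: "\<bar>poly (q k) t\<bar> \<le> \<kappa>" if "k < r" "t \<in> {0..1}" for k t
  proof -
    have "\<bar>poly (q k) t\<bar> \<le> \<bar>\<kappa>0 k\<bar>" using \<kappa>0[OF that(2), of k] by simp
    also have "\<dots> \<le> \<kappa>" unfolding \<kappa>_def by (rule member_le_sum) (use that in auto)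
    finally show ?thesis .
  qed
  have \<kappa>nn: "0 \<le> \<kappa>" by (simp add: \<kappa>_def sum_nonneg)
  define K where "K = 4 * (1 + 8 * real r * 2 ^ r * real M * (1 + 2 ^ r) ^ M)"
  have K: "0 < K" unfolding K_def by (intro mult_pos_pos add_pos_nonneg) auto
  define C where "C = K + 2 * \<kappa> * real r"
  have C: "0 < C" "K \<le> C" "2 * \<kappa> * real r \<le> C" using K \<kappa>nn by (auto simp: C_def add_pos_nonneg)
  show ?thesis
  proof (rule that[of C M q])
    show "degree (q k) < r" if "k < r" for k using q(1)[of k] r by auto
    fix p a b l f B assume p: "1 \<le> p" and ab: "a $ l < b $ l" and f: "f \<in> borel_measurable borel"
      and fB: "Lp_le p (\<lambda>x :: real ^ 'd. indicator (cbox a b) x * f x) B"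
    have PB: "Lp_le p (\<lambda>x. indicator (cbox a b) x * dir_proj q r M l a b f x) (2 * \<kappa> * real r * B)"
      by (rule Lp_le_dir_proj[OF p ab rM f fB \<kappa> \<kappa>nn])
    show "Lp_le p (\<lambda>x. indicator (cbox a b) x * dir_proj q r M l a b f x) (C * B)"
      by (rule Lp_le_mono[OF PB Lp_le_measurable[OF PB]])
         (use C Lp_le_nonneg[OF fB] in \<open>auto intro: mult_right_mono\<close>)
    fix W assume W: "\<And>\<eta>. \<bar>\<eta>\<bar> \<le> b $ l - a $ l \<Longrightarrow> Lp_le p (dir_diff l a b r \<eta> f) W"
    have E: "Lp_le p (\<lambda>x. indicator (cbox a b) x * (f x - dir_proj q r M l a b f x)) (K * W)"
      unfolding K_def by (rule Lp_le_dir_proj_error[OF p ab r M_def q f fB PB W])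
    show "Lp_le p (\<lambda>x. indicator (cbox a b) x * (f x - dir_proj q r M l a b f x)) (C * W)"
      by (rule Lp_le_mono[OF E Lp_le_measurable[OF E]])
         (use C Lp_le_nonneg[OF W[of 0]] ab in \<open>auto intro: mult_right_mono\<close>)
  qed (use C rM in auto)
qed

section \<open>Composition of the directions\<close>

text \<open>
  Polynomials in the coordinates of \<open>S\<close>, of degree less than \<open>r $ i\<close> in the \<open>i\<close>-th one, whose
  coefficients are integrable functions of the remaining coordinates. These are the intermediate
  approximants: for \<open>S = {}\<close> every integrable function is admitted, for \<open>S = UNIV\<close> only
  polynomials remain.
\<close>

inductive coord_poly :: "real ^ 'd \<Rightarrow> real ^ 'd \<Rightarrow> nat ^ 'd \<Rightarrow> 'd set \<Rightarrow> (real ^ 'd \<Rightarrow> real) \<Rightarrow> bool"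
  for a b r S where
  monomial: "v \<in> borel_measurable borel \<Longrightarrow> Lp_le 1 (\<lambda>x. indicator (cbox a b) x * v x) B \<Longrightarrow>
     (\<And>x y. (\<And>i. i \<notin> S \<Longrightarrow> x $ i = y $ i) \<Longrightarrow> v x = v y) \<Longrightarrow> (\<And>i. i \<in> S \<Longrightarrow> \<kappa> i < r $ i) \<Longrightarrow>
     coord_poly a b r S (\<lambda>x. v x * (\<Prod>i\<in>S. x $ i ^ \<kappa> i))"
| add: "coord_poly a b r S f \<Longrightarrow> coord_poly a b r S g \<Longrightarrow> coord_poly a b r S (\<lambda>x. f x + g x)"

lemma coord_poly_sum:
  assumes "finite K" "K \<noteq> {}" "\<And>k. k \<in> K \<Longrightarrow> coord_poly a b r S (f k)"
  shows "coord_poly a b r S (\<lambda>x. \<Sum>k\<in>K. f k x)"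
  using assms by (induction rule: finite_ne_induct) (auto intro: coord_poly.add)

lemma measurable_prod_power:
  "(\<lambda>x :: real ^ 'd. \<Prod>i\<in>S. x $ i ^ \<kappa> i) \<in> borel_measurable borel"
  by (intro borel_measurable_continuous_onI continuous_intros)

lemma coord_poly_L1:
  fixes a b :: "real ^ 'd"
  assumes "coord_poly a b r S f"
  shows "f \<in> borel_measurable borel \<and> (\<exists>B. Lp_le 1 (\<lambda>x. indicator (cbox a b) x * f x) B)"
  using assms
proof induction
  case (monomial v B \<kappa>)
  note [measurable] = monomial(1) measurable_prod_power
  have "bounded ((\<lambda>x :: real ^ 'd. \<Prod>i\<in>S. x $ i ^ \<kappa> i) ` cbox a b)"
    by (intro compact_imp_bounded compact_continuous_image continuous_intros) auto
  then obtain R where R: "\<And>x. x \<in> cbox a b \<Longrightarrow> \<bar>\<Prod>i\<in>S. x $ i ^ \<kappa> i\<bar> \<le> R" by (auto simp: bounded_iff)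
  have "Lp_le 1 (\<lambda>x. indicator (cbox a b) x * (v x * (\<Prod>i\<in>S. x $ i ^ \<kappa> i))) (\<bar>R\<bar> * B)"
  proof (rule Lp_le_mono[OF Lp_le_cmult[OF monomial(2)]])
    fix x
    show "\<bar>indicator (cbox a b) x * (v x * (\<Prod>i\<in>S. x $ i ^ \<kappa> i))\<bar> \<le> \<bar>R * (indicator (cbox a b) x * v x)\<bar>"
    proof (cases "x \<in> cbox a b")
      case True
      have "\<bar>v x\<bar> * \<bar>\<Prod>i\<in>S. x $ i ^ \<kappa> i\<bar> \<le> \<bar>v x\<bar> * \<bar>R\<bar>" using R[OF True] by (intro mult_left_mono) auto
      then show ?thesis using True by (simp add: abs_mult mult.commute)
    qed simp
  qed auto
  then show ?case by (intro conjI exI) measurable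
next
  case (add f g)
  then obtain A B where m[measurable]: "f \<in> borel_measurable borel" "g \<in> borel_measurable borel"
    and AB: "Lp_le 1 (\<lambda>x. indicator (cbox a b) x * f x) A" "Lp_le 1 (\<lambda>x. indicator (cbox a b) x * g x) B" by blast
  have "Lp_le 1 (\<lambda>x. indicator (cbox a b) x * (f x + g x)) (A + B)"
    by (rule Lp_le_mono[OF Lp_le_add[OF _ AB]]) (auto simp: indicator_def)
  then show ?case using m by auto
qed

lemma dir_proj_add_diff:
  fixes f g :: "real ^ 'd \<Rightarrow> real"
  assumes f: "slice_integrable l a b f x" and g: "slice_integrable l a b g x" and r: "r \<le> M"
  shows dir_proj_add: "dir_proj q r M l a b (\<lambda>x. f x + g x) x = dir_proj q r M l a b f x + dir_proj q r M l a b g x"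
    and dir_proj_diff: "dir_proj q r M l a b (\<lambda>x. f x - g x) x = dir_proj q r M l a b f x - dir_proj q r M l a b g x"
proof -
  have "cell_int l a b M k (\<lambda>x. f x + g x) x = cell_int l a b M k f x + cell_int l a b M k g x"
    and "cell_int l a b M k (\<lambda>x. f x - g x) x = cell_int l a b M k f x - cell_int l a b M k g x" if "k < r" for k
    using integrable_cell_slice[OF f, of k M] integrable_cell_slice[OF g, of k M] that r
    by (auto simp: cell_int_def distrib_left right_diff_distrib)
  then show "dir_proj q r M l a b (\<lambda>x. f x + g x) x = dir_proj q r M l a b f x + dir_proj q r M l a b g x"
    "dir_proj q r M l a b (\<lambda>x. f x - g x) x = dir_proj q r M l a b f x - dir_proj q r M l a b g x"
    unfolding dir_proj_def sum.distrib[symmetric] sum_subtractf[symmetric]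
    by (auto simp: distrib_left right_diff_distrib intro!: sum.cong)
qed

lemma poly_par_eq_sum:
  assumes "degree q < n"
  obtains c where "\<And>x :: real ^ 'd. poly q (par l a b x) = (\<Sum>j<n. c j * x $ l ^ j)"
proof -
  define q' where "q' = pcompose q [:- a $ l / (b $ l - a $ l), 1 / (b $ l - a $ l):]"
  have "degree q' \<le> degree q" unfolding q'_def
    by (rule order.trans[OF degree_pcompose_le]) (simp add: degree_pCons_eq_if)
  then have d: "degree q' < n" using assms by simp
  have "poly q (par l a b x) = (\<Sum>j<n. coeff q' j * x $ l ^ j)" for x
  proof -
    have "poly q (par l a b x) = poly q' (x $ l)"
      by (simp add: q'_def poly_pcompose par_def diff_divide_distrib)
    also have "\<dots> = (\<Sum>j\<le>degree q'. coeff q' j * x $ l ^ j)" by (rule poly_altdef)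
    also have "\<dots> = (\<Sum>j<n. coeff q' j * x $ l ^ j)"
      by (rule sum.mono_neutral_left) (use d in \<open>auto simp: coeff_eq_0\<close>)
    finally show ?thesis .
  qed
  then show ?thesis by (rule that)
qed

text \<open>
  The operator in direction \<open>l\<close> acts on the coefficients only, because the monomials in the other
  coordinates are constant along the edges. Its values are polynomials in \<open>x $ l\<close> whose coefficients
  are cell integrals, which no longer depend on \<open>x $ l\<close>. The equality is an almost everywhere one
  since additivity of the cell integrals requires integrable slices.
\<close>

lemma dir_proj_coord_poly:
  fixes a b :: "real ^ 'd"
  assumes "coord_poly a b r S f" and ab: "a $ l < b $ l" and l: "l \<notin> S" and r: "1 \<le> r $ l" "r $ l \<le> M"
    and q: "\<And>k. k < r $ l \<Longrightarrow> degree (q k) < r $ l"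
  shows "\<exists>g. coord_poly a b r (insert l S) g \<and> (AE x in lborel. x \<in> cbox a b \<longrightarrow> g x = dir_proj q (r $ l) M l a b f x)"
  using assms(1)
proof induction
  case (monomial v B \<kappa>)
  note [measurable] = monomial(1)
  have "\<exists>c. \<forall>x :: real ^ 'd. poly (q k) (par l a b x) = (\<Sum>j<r $ l. c j * x $ l ^ j)" if "k < r $ l" for k
    by (rule poly_par_eq_sum[OF q[OF that], of l a b]) blast
  then obtain c where c: "\<And>k x. k < r $ l \<Longrightarrow> poly (q k) (par l a b x) = (\<Sum>j<r $ l. c k j * x $ l ^ j)" by metis
  define m where "m x = (\<Prod>i\<in>S. x $ i ^ \<kappa> i)" for x :: "real ^ 'd"
  have mline: "m (line l a b x s) = m x" for x s
    unfolding m_def using l by (intro prod.cong) (auto simp: line_def)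
  have "dir_proj q (r $ l) M l a b (\<lambda>x. v x * m x) x
     = (\<Sum>k<r $ l. \<Sum>j<r $ l. c k j * cell_int l a b M k v x * (\<Prod>i\<in>insert l S. x $ i ^ (\<kappa>(l := j)) i))" for x
  proof -
    have ci: "cell_int l a b M k (\<lambda>x. v x * m x) x = m x * cell_int l a b M k v x" for k
      by (simp add: cell_int_def mline mult_ac)
    have pr: "(\<Prod>i\<in>insert l S. x $ i ^ (\<kappa>(l := j)) i) = x $ l ^ j * m x" for j
    proof -
      have "(\<Prod>i\<in>S. x $ i ^ (\<kappa>(l := j)) i) = m x" unfolding m_def using l by (intro prod.cong) auto
      then show ?thesis using l by simp
    qed
    show ?thesis unfolding dir_proj_def ci pr
      by (intro sum.cong refl) (auto simp: c sum_distrib_left sum_distrib_right mult_ac)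
  qed
  moreover have "coord_poly a b r (insert l S) (\<lambda>x. \<Sum>k<r $ l. \<Sum>j<r $ l. c k j * cell_int l a b M k v x * (\<Prod>i\<in>insert l S. x $ i ^ (\<kappa>(l := j)) i))"
  proof (intro coord_poly_sum finite_lessThan)
    have "0 \<in> {..<r $ l}" using r by simp
    then show "{..<r $ l} \<noteq> {}" "{..<r $ l} \<noteq> {}" by blast+
    fix k j assume k: "k \<in> {..<r $ l}" and j: "j \<in> {..<r $ l}"
    have kM: "k < M" using k r by simp
    have L: "Lp_le 1 (\<lambda>x. indicator (cbox a b) x * (c k j * cell_int l a b M k v x)) (\<bar>c k j\<bar> * (2 * B))"
      using Lp_le_cmult[OF Lp_le_cell_int[of 1 a l b, OF order_refl ab kM monomial(1,2)], of "c k j"] by (simp add: mult_ac)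
    show "coord_poly a b r (insert l S) (\<lambda>x. c k j * cell_int l a b M k v x * (\<Prod>i\<in>insert l S. x $ i ^ (\<kappa>(l := j)) i))"
    proof (rule coord_poly.monomial[OF _ L])
      fix x y :: "real ^ 'd" assume eq: "\<And>i. i \<notin> insert l S \<Longrightarrow> x $ i = y $ i"
      have "v (line l a b x s) = v (line l a b y s)" for s
        by (rule monomial(3)) (use eq in \<open>auto simp: line_def\<close>)
      then show "c k j * cell_int l a b M k v x = c k j * cell_int l a b M k v y" by (simp add: cell_int_def)
    next
      fix i assume "i \<in> insert l S"
      then show "(\<kappa>(l := j)) i < r $ i" using monomial(4) j by auto
    qed measurable
  qed
  ultimately show ?case unfolding m_def by (intro exI conjI) auto
next
  case (add f g)
  then obtain f' g' where fg: "coord_poly a b r (insert l S) f'" "coord_poly a b r (insert l S) g'"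
    "AE x in lborel. x \<in> cbox a b \<longrightarrow> f' x = dir_proj q (r $ l) M l a b f x"
    "AE x in lborel. x \<in> cbox a b \<longrightarrow> g' x = dir_proj q (r $ l) M l a b g x" by blast
  have si: "AE x in lborel. x \<in> cbox a b \<longrightarrow> slice_integrable l a b h x" if "coord_poly a b r S h" for h
    using coord_poly_L1[OF that] AE_slice_integrable[of a l b, OF ab] by blast
  have "AE x in lborel. x \<in> cbox a b \<longrightarrow> f' x + g' x = dir_proj q (r $ l) M l a b (\<lambda>x. f x + g x) x"
    using fg(3,4) si[OF add(1)] si[OF add(2)] by eventually_elim (use r in \<open>auto simp: dir_proj_add\<close>)
  then show ?case using coord_poly.add[OF fg(1,2)] by blast
qed

text \<open>
  A coefficient that depends on no coordinate is constant.
\<close>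

lemma coord_poly_UNIV:
  fixes a b :: "real ^ 'd"
  assumes "coord_poly a b r UNIV f" shows "f \<in> poly_space r"
  using assms
proof induction
  case (monomial v B \<kappa>)
  have v: "v x = v 0" for x by (rule monomial(3)) simp
  define k0 :: "nat ^ 'd" where "k0 = (\<chi> i. \<kappa> i)"
  have k0: "k0 \<in> {k. \<forall>i. k $ i < r $ i}" using monomial(4) by (simp add: k0_def)
  have "(\<Sum>k | \<forall>i. k $ i < r $ i. (if k = k0 then v 0 else 0) * (\<Prod>i\<in>UNIV. x $ i ^ (k $ i))) = v x * (\<Prod>i\<in>UNIV. x $ i ^ \<kappa> i)" for x :: "real ^ 'd"
  proof -
    have "(\<Sum>k | \<forall>i. k $ i < r $ i. (if k = k0 then v 0 else 0) * (\<Prod>i\<in>UNIV. x $ i ^ (k $ i)))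
       = (\<Sum>k | \<forall>i. k $ i < r $ i. if k = k0 then v 0 * (\<Prod>i\<in>UNIV. x $ i ^ (k0 $ i)) else 0)"
      by (intro sum.cong) auto
    also have "\<dots> = v 0 * (\<Prod>i\<in>UNIV. x $ i ^ (k0 $ i))"
      using k0 by (subst sum.delta) (auto simp: finite_multi_indices)
    finally show ?thesis by (simp add: k0_def v[of x])
  qed
  then show ?case unfolding poly_space_def mem_Collect_eq
    by (intro exI[of _ "\<lambda>k. if k = k0 then v 0 else 0"] ext) (rule sym)
next
  case (add f g)
  then obtain c d where "f = (\<lambda>x. \<Sum>k | \<forall>i. k $ i < r $ i. c k * (\<Prod>i\<in>UNIV. (x $ i) ^ (k $ i)))"
    "g = (\<lambda>x. \<Sum>k | \<forall>i. k $ i < r $ i. d k * (\<Prod>i\<in>UNIV. (x $ i) ^ (k $ i)))" unfolding poly_space_def by blast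
  then show ?case unfolding poly_space_def mem_Collect_eq
    by (intro exI[of _ "\<lambda>k. c k + d k"]) (simp add: algebra_simps sum.distrib)
qed

text \<open>
  The constant is uniform in \<open>p\<close>, the box, the function and the bound \<open>W\<close> for its directional
  differences. The bound \<open>B\<close> only expresses that \<open>f\<close> has a finite norm.
\<close>

definition Whitney_const :: "nat ^ 'd \<Rightarrow> 'd set \<Rightarrow> real \<Rightarrow> bool" where
  "Whitney_const r S C \<longleftrightarrow> (\<forall>p (a :: real ^ 'd) b f B W. 1 \<le> p \<longrightarrow> (\<forall>i. a $ i < b $ i) \<longrightarrow> f \<in> borel_measurable borel \<longrightarrow>
     Lp_le p (\<lambda>x. indicator (cbox a b) x * f x) B \<longrightarrow>
     (\<forall>l \<eta>. \<bar>\<eta>\<bar> \<le> b $ l - a $ l \<longrightarrow> Lp_le p (dir_diff l a b (r $ l) \<eta> f) W) \<longrightarrow>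
     (\<exists>g. coord_poly a b r S g \<and> Lp_le p (\<lambda>x. indicator (cbox a b) x * (f x - g x)) (C * W)))"

lemma Whitney_constD:
  fixes a b :: "real ^ 'd"
  assumes "Whitney_const r S C" "1 \<le> p" "\<forall>i. a $ i < b $ i" "f \<in> borel_measurable borel"
    "Lp_le p (\<lambda>x. indicator (cbox a b) x * f x) B"
    "\<And>l \<eta>. \<bar>\<eta>\<bar> \<le> b $ l - a $ l \<Longrightarrow> Lp_le p (dir_diff l a b (r $ l) \<eta> f) W"
  obtains g where "coord_poly a b r S g" "Lp_le p (\<lambda>x. indicator (cbox a b) x * (f x - g x)) (C * W)"
proof -
  have "\<forall>l \<eta>. \<bar>\<eta>\<bar> \<le> b $ l - a $ l \<longrightarrow> Lp_le p (dir_diff l a b (r $ l) \<eta> f) W" using assms(6) by blast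
  then show ?thesis
    using assms(1)[unfolded Whitney_const_def, rule_format, of p a b f B W] assms(2-5) that by blast
qed

text \<open>
  Induction over the directions. If \<open>g\<close> is the approximant for \<open>S\<close> and \<open>P\<close> the operator in a new
  direction, then \<open>P g\<close> is the next approximant, and \<open>f - P g = (f - P f) + P (f - g)\<close>. The first
  term is estimated by the modulus in the new direction and the second by boundedness of \<open>P\<close>;
  moduli of mixed directions never enter.
\<close>

lemma Whitney_coordinates:
  fixes r :: "nat ^ 'd"
  assumes r: "\<And>i. 1 \<le> r $ i" and "finite S"
  shows "\<exists>C\<ge>0. Whitney_const r S C"
  using assms(2)
proof induction
  case empty
  have "Whitney_const r {} 0" unfolding Whitney_const_def
  proof (intro allI impI)
    fix p and a b :: "real ^ 'd" and f B W assume *: "1 \<le> p" "f \<in> borel_measurable borel" "Lp_le p (\<lambda>x. indicator (cbox a b) x * f x) B"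
    obtain B' where B': "Lp_le 1 (\<lambda>x. indicator (cbox a b) x * f x) B'" using Lp_le_imp_L1_le[OF *(1,3)] by blast
    have "f x = f y" if "\<And>i. i \<notin> {} \<Longrightarrow> x $ i = y $ i" for x y
      using that by (metis empty_iff vec_eq_iff)
    then have "coord_poly a b r {} (\<lambda>x. f x * (\<Prod>i\<in>{}. x $ i ^ 0))"
      by (rule coord_poly.monomial[OF *(2) B']) simp_all
    then show "\<exists>g. coord_poly a b r {} g \<and> Lp_le p (\<lambda>x. indicator (cbox a b) x * (f x - g x)) (0 * W)"
      using Lp_le_zero[OF *(1) order_refl] by (intro exI[of _ f]) simp
  qed
  then show ?case by (intro exI[of _ 0]) simp
next
  case (insert l S)
  then obtain C where C: "0 \<le> C" "Whitney_const r S C" by blast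
  obtain M D and q :: "nat \<Rightarrow> real poly" where D: "0 < D" "r $ l \<le> M" "\<And>k. k < r $ l \<Longrightarrow> degree (q k) < r $ l"
    and D1: "\<And>p a b l' f B. 1 \<le> p \<Longrightarrow> a $ l' < b $ l' \<Longrightarrow> f \<in> borel_measurable borel \<Longrightarrow>
        Lp_le p (\<lambda>x :: real ^ 'd. indicator (cbox a b) x * f x) B \<Longrightarrow>
        Lp_le p (\<lambda>x. indicator (cbox a b) x * dir_proj q (r $ l) M l' a b f x) (D * B)"
    and D2: "\<And>p a b l' f B W. 1 \<le> p \<Longrightarrow> a $ l' < b $ l' \<Longrightarrow> f \<in> borel_measurable borel \<Longrightarrow>
        Lp_le p (\<lambda>x :: real ^ 'd. indicator (cbox a b) x * f x) B \<Longrightarrow>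
        (\<And>\<eta>. \<bar>\<eta>\<bar> \<le> b $ l' - a $ l' \<Longrightarrow> Lp_le p (dir_diff l' a b (r $ l) \<eta> f) W) \<Longrightarrow>
        Lp_le p (\<lambda>x. indicator (cbox a b) x * (f x - dir_proj q (r $ l) M l' a b f x)) (D * W)"
    by (rule directional_Whitney[OF r[of l]]) blast
  have "Whitney_const r (insert l S) (D + D * C)" unfolding Whitney_const_def
  proof (intro allI impI)
    fix p and a b :: "real ^ 'd" and f B W assume p: "1 \<le> p" and ab: "\<forall>i. a $ i < b $ i" and f[measurable]: "f \<in> borel_measurable borel"
      and fB: "Lp_le p (\<lambda>x. indicator (cbox a b) x * f x) B"
      and W: "\<forall>l \<eta>. \<bar>\<eta>\<bar> \<le> b $ l - a $ l \<longrightarrow> Lp_le p (dir_diff l a b (r $ l) \<eta> f) W"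
    have abl: "a $ l < b $ l" using ab by blast
    obtain g where g: "coord_poly a b r S g" "Lp_le p (\<lambda>x. indicator (cbox a b) x * (f x - g x)) (C * W)"
      by (rule Whitney_constD[OF C(2) p ab f fB]) (use W in blast)+
    from coord_poly_L1[OF g(1)] obtain B2 where gm[measurable]: "g \<in> borel_measurable borel"
      and g1: "Lp_le 1 (\<lambda>x. indicator (cbox a b) x * g x) B2" by blast
    obtain B1 where f1: "Lp_le 1 (\<lambda>x. indicator (cbox a b) x * f x) B1" using Lp_le_imp_L1_le[OF p fB] by blast
    let ?P = "dir_proj q (r $ l) M l a b"
    obtain g' where g': "coord_poly a b r (insert l S) g'" "AE x in lborel. x \<in> cbox a b \<longrightarrow> g' x = ?P g x"
      using dir_proj_coord_poly[OF g(1) abl insert(2) r D(2), where q = q] D(3) by blast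
    have [measurable]: "g' \<in> borel_measurable borel" using coord_poly_L1[OF g'(1)] by blast
    have E1: "Lp_le p (\<lambda>x. indicator (cbox a b) x * (f x - ?P f x)) (D * W)"
      by (rule D2[OF p abl f fB]) (use W in blast)
    have E2: "Lp_le p (\<lambda>x. indicator (cbox a b) x * ?P (\<lambda>x. f x - g x) x) (D * (C * W))"
      by (rule D1[OF p abl _ g(2)]) measurable
    have "AE x in lborel. \<bar>indicator (cbox a b) x * (f x - g' x)\<bar> \<le>
       \<bar>\<bar>indicator (cbox a b) x * (f x - ?P f x)\<bar> + \<bar>indicator (cbox a b) x * ?P (\<lambda>x. f x - g x) x\<bar>\<bar>"
      using g'(2) AE_slice_integrable[of a l b, OF abl f1 f] AE_slice_integrable[of a l b, OF abl g1 gm]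
    proof eventually_elim
      case (elim x)
      then show ?case
        by (cases "x \<in> cbox a b") (use D(2) in \<open>auto simp: dir_proj_diff\<close>)
    qed
    then have "Lp_le p (\<lambda>x. indicator (cbox a b) x * (f x - g' x)) (D * W + D * (C * W))"
      by (intro Lp_le_AE_mono[OF Lp_le_add[OF p E1 E2]]) auto
    then show "\<exists>g. coord_poly a b r (insert l S) g \<and> Lp_le p (\<lambda>x. indicator (cbox a b) x * (f x - g x)) ((D + D * C) * W)"
      using g'(1) by (intro exI[of _ g']) (simp add: algebra_simps)
  qed
  moreover have "0 \<le> D + D * C" using D C by simp
  ultimately show ?case by blast
qed

section \<open>Mixed differences\<close>

lemma fold_partial_fdiff_insert:
  fixes r :: "nat ^ 'd" and h :: "real ^ 'd" and A :: "'d set"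
  assumes "i \<notin> A"
  shows "Finite_Set.fold (\<lambda>i. partial_fdiff i (r $ i) (h $ i)) f (insert i A)
       = partial_fdiff i (r $ i) (h $ i) (Finite_Set.fold (\<lambda>i. partial_fdiff i (r $ i) (h $ i)) f A)"
proof -
  interpret comp_fun_commute "\<lambda>i. partial_fdiff i (r $ i) (h $ i)" by (rule comp_fun_commute_partial_fdiff)
  show ?thesis using assms by (intro fold_insert) auto
qed

lemma fold_partial_fdiff_diff:
  fixes r :: "nat ^ 'd" and h :: "real ^ 'd" and A :: "'d set"
  shows "Finite_Set.fold (\<lambda>i. partial_fdiff i (r $ i) (h $ i)) (\<lambda>x. f x - g x) A
       = (\<lambda>x. Finite_Set.fold (\<lambda>i. partial_fdiff i (r $ i) (h $ i)) f A x - Finite_Set.fold (\<lambda>i. partial_fdiff i (r $ i) (h $ i)) g A x)"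
proof -
  have "finite A" by simp
  then show ?thesis
  proof induction
    case (insert i A)
    show ?case unfolding fold_partial_fdiff_insert[OF insert(2)] insert(3)
      by (simp add: partial_fdiff_def fdiff_diff fun_eq_iff)
  qed simp
qed

lemma fold_partial_fdiff_zero:
  fixes r :: "nat ^ 'd" and h :: "real ^ 'd" and A :: "'d set"
  shows "Finite_Set.fold (\<lambda>i. partial_fdiff i (r $ i) (h $ i)) (\<lambda>x. 0) A = (\<lambda>x. 0)"
  using fold_partial_fdiff_diff[of r h "\<lambda>x. 0" "\<lambda>x. 0" A] by simp

lemma partial_fdiff_order_0 [simp]: "partial_fdiff i 0 \<eta> f = f"
  by (simp add: partial_fdiff_eq_sum fun_eq_iff)

lemma fold_partial_fdiff_order_0:
  fixes r :: "nat ^ 'd" and h :: "real ^ 'd" and A :: "'d set"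
  assumes "\<And>i. i \<in> A \<Longrightarrow> r $ i = 0"
  shows "Finite_Set.fold (\<lambda>i. partial_fdiff i (r $ i) (h $ i)) f A = f"
proof -
  have "finite A" by simp
  then show ?thesis using assms
  proof induction
    case (insert i A)
    then show ?case unfolding fold_partial_fdiff_insert[OF insert(2)] by simp
  qed simp
qed

lemma mixed_diff_single:
  "mixed_diff (restrict_index r {l}) h f = partial_fdiff l (r $ l) (h $ l) f"
proof -
  have "(UNIV :: 'a set) = insert l (UNIV - {l})" by auto
  then have "mixed_diff (restrict_index r {l}) h f
     = Finite_Set.fold (\<lambda>i. partial_fdiff i (restrict_index r {l} $ i) (h $ i)) f (insert l (UNIV - {l}))"
    by (simp add: mixed_diff_def)
  also have "\<dots> = partial_fdiff l (restrict_index r {l} $ l) (h $ l) f"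
  proof (subst fold_partial_fdiff_insert)
    have "Finite_Set.fold (\<lambda>i. partial_fdiff i (restrict_index r {l} $ i) (h $ i)) f (UNIV - {l}) = f"
      by (rule fold_partial_fdiff_order_0) (simp add: restrict_index_def)
    then show "partial_fdiff l (restrict_index r {l} $ l) (h $ l)
        (Finite_Set.fold (\<lambda>i. partial_fdiff i (restrict_index r {l} $ i) (h $ i)) f (UNIV - {l}))
      = partial_fdiff l (restrict_index r {l} $ l) (h $ l) f" by simp
  qed simp
  finally show ?thesis by (simp add: restrict_index_def)
qed

text \<open>
  Along each line of direction \<open>i\<close> an element of the space is a univariate polynomial of degree less
  than \<open>r $ i\<close>.
\<close>

lemma partial_fdiff_poly_space:
  assumes \<phi>: "\<phi> \<in> poly_space r" and r: "1 \<le> r $ i"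
  shows "partial_fdiff i (r $ i) \<eta> \<phi> = (\<lambda>x. 0)"
proof
  fix x :: "real ^ 'a"
  from \<phi> obtain c where c: "\<phi> = (\<lambda>x. \<Sum>k | \<forall>i. k $ i < r $ i. c k * (\<Prod>i\<in>UNIV. (x $ i) ^ (k $ i)))"
    by (auto simp: poly_space_def)
  define q where "q = (\<Sum>k | \<forall>i. k $ i < r $ i. smult (c k * (\<Prod>j\<in>UNIV - {i}. x $ j ^ (k $ j))) (monom 1 (k $ i)))"
  have "\<phi> (\<chi> k. if k = i then s else x $ k) = poly q s" for s
  proof -
    have "(\<Prod>j\<in>UNIV. (\<chi> k. if k = i then s else x $ k) $ j ^ (k $ j)) = (\<Prod>j\<in>UNIV - {i}. x $ j ^ (k $ j)) * s ^ (k $ i)" for k :: "nat ^ 'a"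
      by (subst prod.remove[of _ i]) (auto simp: mult.commute intro!: prod.cong)
    then show ?thesis by (simp add: c q_def poly_sum poly_monom mult_ac)
  qed
  moreover have "degree q < r $ i"
  proof -
    have "degree q \<le> r $ i - 1" unfolding q_def
    proof (intro degree_sum_le finite_multi_indices)
      fix k assume "k \<in> {k. \<forall>i. k $ i < r $ i}"
      then have "k $ i \<le> r $ i - 1" by (metis One_nat_def Suc_pred' less_Suc_eq_le mem_Collect_eq not_gr_zero not_less_zero)
      then show "degree (smult (c k * (\<Prod>j\<in>UNIV - {i}. x $ j ^ (k $ j))) (monom 1 (k $ i))) \<le> r $ i - 1"
        using order.trans[OF degree_smult_le degree_monom_le] order.trans by blast
    qed
    then show ?thesis using r by linarith
  qed
  ultimately show "partial_fdiff i (r $ i) \<eta> \<phi> x = 0"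
    by (simp add: partial_fdiff_def fdiff_poly_eq_0)
qed

text \<open>
  By commutativity, the difference operator in some direction \<open>i \<in> e\<close> may be applied first, and it
  annihilates \<open>\<phi>\<close>.
\<close>

lemma mixed_diff_poly_space:
  assumes \<phi>: "\<phi> \<in> poly_space r" and r: "\<And>i. 1 \<le> r $ i" and e: "e \<noteq> {}"
  shows "mixed_diff (restrict_index r e) h (\<lambda>x. f x - \<phi> x) = mixed_diff (restrict_index r e) h f"
proof -
  obtain i where i: "i \<in> e" using e by blast
  define F where "F i = partial_fdiff i (restrict_index r e $ i) (h $ i)" for i
  interpret comp_fun_commute F unfolding F_def by (rule comp_fun_commute_partial_fdiff)
  have "F i \<phi> = (\<lambda>x. 0)" using partial_fdiff_poly_space[OF \<phi> r] i by (simp add: F_def restrict_index_def)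
  moreover have "Finite_Set.fold F \<phi> (insert i (UNIV - {i})) = Finite_Set.fold F (F i \<phi>) (UNIV - {i})"
    by (rule fold_insert2) auto
  ultimately have "Finite_Set.fold F \<phi> UNIV = (\<lambda>x. 0)"
    using fold_partial_fdiff_zero[of "restrict_index r e" h "UNIV - {i}"] by (simp add: F_def[symmetric] insert_UNIV)
  then show ?thesis
    unfolding mixed_diff_def fold_partial_fdiff_diff by (simp add: F_def[symmetric])
qed

text \<open>
  Both \<open>x\<close> and \<open>x + y\<close> lie in the box, and each coordinate of the translated point lies between the
  corresponding coordinates of these two.
\<close>

lemma translate_in_shift_domain:
  fixes a b :: "real ^ 'd"
  assumes x: "x \<in> shift_domain (cbox a b) (\<chi> k. if k \<in> insert i A then real (r $ k) * h $ k else 0)"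
    and i: "i \<notin> A" and j: "j \<le> r $ i"
  shows "x + (real j * h $ i) *\<^sub>R axis i 1 \<in> shift_domain (cbox a b) (\<chi> k. if k \<in> A then real (r $ k) * h $ k else 0)"
proof -
  let ?y = "\<chi> k. if k \<in> A then real (r $ k) * h $ k else 0"
  let ?z = "x + (real j * h $ i) *\<^sub>R axis i 1"
  have xk: "a $ k \<le> x $ k" "x $ k \<le> b $ k" for k using x by (auto simp: shift_domain_def mem_box_cart)
  have xy: "a $ k \<le> x $ k + (if k \<in> insert i A then real (r $ k) * h $ k else 0)"
    "x $ k + (if k \<in> insert i A then real (r $ k) * h $ k else 0) \<le> b $ k" for k
    using x by (auto simp: shift_domain_def mem_box_cart simp del: insert_iff)
  have xi: "a $ i \<le> x $ i + real (r $ i) * h $ i" "x $ i + real (r $ i) * h $ i \<le> b $ i"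
    and xA: "k \<in> A \<Longrightarrow> a $ k \<le> x $ k + real (r $ k) * h $ k" "k \<in> A \<Longrightarrow> x $ k + real (r $ k) * h $ k \<le> b $ k" for k
    using xy[of i] xy[of k] by simp_all
  have zi: "a $ i \<le> x $ i + real j * h $ i" "x $ i + real j * h $ i \<le> b $ i"
  proof -
    have "min 0 (real (r $ i) * h $ i) \<le> real j * h $ i \<and> real j * h $ i \<le> max 0 (real (r $ i) * h $ i)"
    proof (cases "0 \<le> h $ i")
      case True
      then show ?thesis using j by (auto intro!: mult_right_mono simp: le_max_iff_disj min_le_iff_disj)
    next
      case False
      then show ?thesis using j by (auto intro!: mult_right_mono_neg simp: le_max_iff_disj min_le_iff_disj mult_nonneg_nonpos)
    qed
    then show "a $ i \<le> x $ i + real j * h $ i" "x $ i + real j * h $ i \<le> b $ i" using xk[of i] xi by linarith+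
  qed
  have "?z \<in> cbox a b" using xk zi by (auto simp: mem_box_cart axis_def)
  moreover have "?z + ?y \<in> cbox a b" using xk zi xA i by (auto simp: mem_box_cart axis_def)
  ultimately show ?thesis by (simp add: shift_domain_def)
qed

lemma sets_shift_domain [measurable]: "shift_domain (cbox a b) y \<in> sets (borel :: (real ^ 'd) measure)"
proof -
  have "shift_domain (cbox a b) y = cbox a b \<inter> (\<lambda>x. x + y) -` cbox a b \<inter> space borel" by (auto simp: shift_domain_def)
  also have "\<dots> \<in> sets borel"
  proof -
    have "(\<lambda>x. x + y) -` cbox a b \<inter> space borel \<in> sets borel" by (rule measurable_sets[of _ borel borel]) auto
    then show ?thesis by (auto simp: Int_assoc)
  qed
  finally show ?thesis .
qed

text \<open>
  One more direction replaces the function by a combination of translates whose coefficients have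
  absolute sum \<open>2 ^ (r $ i)\<close>; all translates evaluate the previous function inside its own domain.
  Hence the norm bound is multiplied by this factor, and almost everywhere equality of two
  functions is inherited by their differences.
\<close>

lemma fold_partial_fdiff_AE_bound:
  fixes r :: "nat ^ 'd" and h :: "real ^ 'd" and A :: "'d set" and a b :: "real ^ 'd"
  assumes p: "1 \<le> p" and [measurable]: "g \<in> borel_measurable borel"
    and eq: "AE x in lborel. x \<in> cbox a b \<longrightarrow> f x = g x"
    and B: "Lp_le p (\<lambda>x. indicator (cbox a b) x * g x) B"
  defines "F \<equiv> \<lambda>f. Finite_Set.fold (\<lambda>i. partial_fdiff i (r $ i) (h $ i)) f A"
  defines "D \<equiv> shift_domain (cbox a b) (\<chi> k. if k \<in> A then real (r $ k) * h $ k else 0)"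
  shows "F g \<in> borel_measurable borel" "AE x in lborel. x \<in> D \<longrightarrow> F f x = F g x"
    "Lp_le p (\<lambda>x. indicator D x * F g x) ((\<Prod>i\<in>A. 2 ^ (r $ i)) * B)"
proof -
  define FF where "FF A f = Finite_Set.fold (\<lambda>i. partial_fdiff i (r $ i) (h $ i)) f A" for A f
  define DD where "DD A = shift_domain (cbox a b) (\<chi> k. if k \<in> A then real (r $ k) * h $ k else 0)" for A
  have "finite A" by simp
  then have "FF A g \<in> borel_measurable borel \<and> (AE x in lborel. x \<in> DD A \<longrightarrow> FF A f x = FF A g x) \<and>
    Lp_le p (\<lambda>x. indicator (DD A) x * FF A g x) ((\<Prod>i\<in>A. 2 ^ (r $ i)) * B)"
  proof induction
    case empty
    have "DD {} = cbox a b"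
    proof -
      have "x + (\<chi> k. 0) = x" for x :: "real ^ 'd" by (simp add: vec_eq_iff)
      then show ?thesis by (auto simp: DD_def shift_domain_def)
    qed
    then show ?case using eq B by (simp add: FF_def)
  next
    case (insert i A)
    then have m[measurable]: "FF A g \<in> borel_measurable borel"
      and ae: "AE x in lborel. x \<in> DD A \<longrightarrow> FF A f x = FF A g x"
      and L: "Lp_le p (\<lambda>x. indicator (DD A) x * FF A g x) ((\<Prod>i\<in>A. 2 ^ (r $ i)) * B)" by auto
    have [measurable]: "DD A \<in> sets borel" for A unfolding DD_def by measurable
    define c where "c j = (-1) ^ (r $ i - j) * real (r $ i choose j)" for j
    define v :: "nat \<Rightarrow> real ^ 'd" where "v j = (real j * h $ i) *\<^sub>R axis i 1" for j
    have F: "FF (insert i A) f x = (\<Sum>j\<le>r $ i. c j * FF A f (x + v j))" for f x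
      unfolding FF_def fold_partial_fdiff_insert[OF insert(2)] partial_fdiff_eq_sum c_def v_def ..
    have D: "x + v j \<in> DD A" if "x \<in> DD (insert i A)" "j \<le> r $ i" for x j
      using translate_in_shift_domain[of x a b i A r h j] that insert(2) unfolding DD_def v_def by blast
    have m': "FF (insert i A) g \<in> borel_measurable borel" unfolding F[abs_def] by measurable
    have "AE x in lborel. \<forall>j\<in>{..r $ i}. x + v j \<in> DD A \<longrightarrow> FF A f (x + v j) = FF A g (x + v j)"
      by (intro AE_finite_allI AE_lborel_translate ae) auto
    then have ae': "AE x in lborel. x \<in> DD (insert i A) \<longrightarrow> FF (insert i A) f x = FF (insert i A) g x"
      by eventually_elim (auto simp: F D intro!: sum.cong)
    have sumc: "(\<Sum>j\<le>r $ i. \<bar>c j\<bar>) = 2 ^ (r $ i)"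
      by (simp add: c_def abs_mult sum_binomials)
    have "Lp_le p (\<lambda>x. \<Sum>j\<le>r $ i. \<bar>c j * (indicator (DD A) (x + v j) * FF A g (x + v j))\<bar>) (\<Sum>j\<le>r $ i. \<bar>c j\<bar> * ((\<Prod>i\<in>A. 2 ^ (r $ i)) * B))"
      by (intro Lp_le_sum[OF p] Lp_le_cmult Lp_le_translate[OF L]) simp
    then have "Lp_le p (\<lambda>x. indicator (DD (insert i A)) x * FF (insert i A) g x) ((\<Prod>i\<in>insert i A. 2 ^ (r $ i)) * B)"
    proof (rule Lp_le_mono)
      fix x
      show "\<bar>indicator (DD (insert i A)) x * FF (insert i A) g x\<bar> \<le> \<bar>\<Sum>j\<le>r $ i. \<bar>c j * (indicator (DD A) (x + v j) * FF A g (x + v j))\<bar>\<bar>"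
      proof (cases "x \<in> DD (insert i A)")
        case True
        have "\<bar>FF (insert i A) g x\<bar> \<le> (\<Sum>j\<le>r $ i. \<bar>c j * FF A g (x + v j)\<bar>)" unfolding F by (rule sum_abs)
        also have "\<dots> = (\<Sum>j\<le>r $ i. \<bar>c j * (indicator (DD A) (x + v j) * FF A g (x + v j))\<bar>)"
          using D[OF True] by (intro sum.cong) auto
        finally show ?thesis using True by simp
      qed simp
    qed (use m' insert(1,2) in \<open>auto simp: sum_distrib_right[symmetric] sumc mult.assoc\<close>)
    then show ?case using m' ae' by blast
  qed
  then show "F g \<in> borel_measurable borel" "AE x in lborel. x \<in> D \<longrightarrow> F f x = F g x"
    "Lp_le p (\<lambda>x. indicator D x * F g x) ((\<Prod>i\<in>A. 2 ^ (r $ i)) * B)"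
    by (auto simp: F_def D_def FF_def DD_def)
qed

lemma mixed_diff_AE_bound:
  fixes r :: "nat ^ 'd" and h :: "real ^ 'd" and a b :: "real ^ 'd"
  assumes p: "1 \<le> p" and g: "g \<in> borel_measurable borel"
    and eq: "AE x in lborel. x \<in> cbox a b \<longrightarrow> f x = g x"
    and B: "Lp_le p (\<lambda>x. indicator (cbox a b) x * g x) B"
  defines "D \<equiv> shift_domain (cbox a b) (\<chi> i. real (r $ i) * h $ i)"
  shows "mixed_diff r h g \<in> borel_measurable borel" "AE x in lborel. x \<in> D \<longrightarrow> mixed_diff r h f x = mixed_diff r h g x"
    "Lp_le p (\<lambda>x. indicator D x * mixed_diff r h g x) ((\<Prod>i\<in>UNIV. 2 ^ (r $ i)) * B)"
  using fold_partial_fdiff_AE_bound[OF p g eq B, where A = UNIV] by (simp_all add: D_def mixed_diff_def)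

section \<open>The two inequalities\<close>

lemma poly_space_measurable: "\<phi> \<in> poly_space r \<Longrightarrow> \<phi> \<in> borel_measurable borel"
  unfolding poly_space_def by (auto intro!: borel_measurable_continuous_onI continuous_intros)

text \<open>
  Slices of a Lebesgue measurable function need not be measurable. Norms and moduli do not see null
  sets, so a Borel representative can take the place of the function.
\<close>

lemma Lp_space_Borel_version:
  assumes p: "1 \<le> p" and f: "f \<in> Lp_space p (cbox a b)"
  obtains g B where "g \<in> borel_measurable borel" "AE x in lborel. x \<in> cbox a b \<longrightarrow> f x = g x"
    "Lp_le p (\<lambda>x. indicator (cbox a b) x * g x) B"
proof -
  have "(\<lambda>x. if x \<in> cbox a b then f x else 0) \<in> borel_measurable lebesgue"
    using f by (subst borel_measurable_if) (auto simp: Lp_space_def)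
  from completion_ex_borel_measurable_real[OF this] obtain g where g: "g \<in> borel_measurable lborel"
    "AE x in lborel. (if x \<in> cbox a b then f x else 0) = g x" by blast
  have g': "g \<in> borel_measurable borel" using g(1) by simp
  have ae: "AE x in lborel. x \<in> cbox a b \<longrightarrow> f x = g x" using g(2) by eventually_elim (auto split: if_splits)
  obtain B where B: "0 \<le> B" "Lp_norm p (cbox a b) f = ennreal B"
    using f by (cases "Lp_norm p (cbox a b) f") (auto simp: Lp_space_def)
  then have "Lp_le p (\<lambda>x. indicator (cbox a b) x * g x) B"
    using Lp_norm_le_iff[OF p _ g' ae B(1)] by simp
  then show ?thesis using that g' ae by blast
qed

text \<open>
  For nonempty \<open>e\<close> the difference of \<open>f\<close> is that of \<open>f - \<phi>\<close>, whose norm is at most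
  \<open>\<Prod>i\<in>e. 2 ^ (r $ i)\<close> times that of \<open>f - \<phi>\<close>; these bounds are summed over \<open>e\<close>.
\<close>

lemma total_modulus_le_best_approx:
  fixes r :: "nat ^ 'd"
  assumes r: "\<And>i. 1 \<le> r $ i" and p: "1 \<le> p" and f: "f \<in> Lp_space p (cbox a b)"
  shows "inverse (\<Sum>e\<in>(UNIV :: 'd set set). \<Prod>i\<in>e. 2 ^ (r $ i)) * total_modulus r f t p (cbox a b)
           \<le> best_approx r f p (cbox a b)"
  unfolding best_approx_def
proof (rule INF_greatest)
  fix \<phi> assume \<phi>: "\<phi> \<in> poly_space r"
  let ?Q = "cbox a b"
  define s :: real where "s = (\<Sum>e\<in>(UNIV :: 'd set set). \<Prod>i\<in>e. 2 ^ (r $ i))"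
  have s: "(\<Sum>e\<in>(UNIV :: 'd set set). \<Prod>i\<in>e. 2 ^ (r $ i)) = ennreal s"
  proof -
    have "(\<Prod>i\<in>e. 2 ^ (r $ i)) = ennreal (\<Prod>i\<in>e. 2 ^ (r $ i))" for e :: "'d set"
      by (simp add: prod_ennreal[symmetric] ennreal_power[symmetric])
    then show ?thesis unfolding s_def by (simp add: sum_ennreal prod_nonneg)
  qed
  have s0: "0 < s" unfolding s_def by (intro sum_pos prod_pos) auto
  obtain g B0 where g[measurable]: "g \<in> borel_measurable borel" and ae: "AE x in lborel. x \<in> ?Q \<longrightarrow> f x = g x"
    and gB: "Lp_le p (\<lambda>x. indicator ?Q x * g x) B0" using Lp_space_Borel_version[OF p f] .
  have [measurable]: "\<phi> \<in> borel_measurable borel" by (rule poly_space_measurable[OF \<phi>])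
  show "inverse (\<Sum>e\<in>(UNIV :: 'd set set). \<Prod>i\<in>e. 2 ^ (r $ i)) * total_modulus r f t p ?Q \<le> Lp_norm p ?Q (\<lambda>x. f x - \<phi> x)"
  proof (cases "Lp_norm p ?Q (\<lambda>x. f x - \<phi> x)")
    case (real B)
    have ae2: "AE x in lborel. x \<in> ?Q \<longrightarrow> f x - \<phi> x = g x - \<phi> x" using ae by eventually_elim simp
    have B: "Lp_le p (\<lambda>x. indicator ?Q x * (g x - \<phi> x)) B"
      using Lp_norm_le_iff[OF p _ _ ae2 real(1)] real(2) by simp
    have mod: "mixed_modulus (restrict_index r e) f t p ?Q \<le> ennreal ((\<Prod>i\<in>e. 2 ^ (r $ i)) * B)" if e: "e \<noteq> {}" for e
      unfolding mixed_modulus_def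
    proof (rule SUP_least)
      fix h
      let ?\<rho> = "restrict_index r e"
      let ?D = "shift_domain ?Q (\<chi> i. real (?\<rho> $ i) * h $ i)"
      have "(\<Prod>i\<in>UNIV. 2 ^ (?\<rho> $ i)) = (\<Prod>i\<in>e. 2 ^ (r $ i) :: real)"
        by (rule prod.mono_neutral_cong_right) (auto simp: restrict_index_def)
      then have "Lp_le p (\<lambda>x. indicator ?D x * mixed_diff ?\<rho> h (\<lambda>x. g x - \<phi> x) x) ((\<Prod>i\<in>e. 2 ^ (r $ i)) * B)"
        using mixed_diff_AE_bound(3)[OF p _ ae2 B, of ?\<rho> h] by simp
      then have L: "Lp_le p (\<lambda>x. indicator ?D x * mixed_diff ?\<rho> h g x) ((\<Prod>i\<in>e. 2 ^ (r $ i)) * B)"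
        unfolding mixed_diff_poly_space[OF \<phi> r e] .
      show "Lp_norm p ?D (mixed_diff ?\<rho> h f) \<le> ennreal ((\<Prod>i\<in>e. 2 ^ (r $ i)) * B)"
        using Lp_norm_le_iff[OF p sets_shift_domain mixed_diff_AE_bound(1,2)[OF p g ae gB] Lp_le_nonneg[OF L]] L by simp
    qed
    have "total_modulus r f t p ?Q \<le> (\<Sum>e | e \<noteq> {}. ennreal ((\<Prod>i\<in>e. 2 ^ (r $ i)) * B))"
      unfolding total_modulus_def by (intro sum_mono mod) simp
    also have "\<dots> \<le> (\<Sum>e\<in>(UNIV :: 'd set set). ennreal ((\<Prod>i\<in>e. 2 ^ (r $ i)) * B))"
      by (intro sum_mono2) auto
    also have "\<dots> = ennreal (s * B)"
      using real(1) by (subst sum_ennreal) (auto simp: s_def sum_distrib_right prod_nonneg)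
    finally have "inverse (ennreal s) * total_modulus r f t p ?Q \<le> inverse (ennreal s) * ennreal (s * B)"
      by (intro mult_left_mono) auto
    also have "\<dots> = ennreal B"
      using s0 real(1) by (simp add: inverse_ennreal ennreal_mult[symmetric])
    finally show ?thesis unfolding s real(2) .
  qed simp
qed

theorem theorem1p1:
  fixes r :: "nat ^ 'd"
  assumes "\<forall>i. r $ i \<ge> 1"
  shows "\<exists>C::real. C > 0 \<and>
    (\<forall>(p::ennreal) (a::real ^ 'd) (b::real ^ 'd).
       p \<ge> 1 \<longrightarrow> (\<forall>i. a $ i < b $ i) \<longrightarrow> (\<forall>f \<in> Lp_space p (cbox a b).
         inverse (\<Sum>e\<in>(UNIV :: 'd set set). \<Prod>i\<in>e. 2 ^ (r $ i))
             * total_modulus r f (b - a) p (cbox a b)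
           \<le> best_approx r f p (cbox a b)
       \<and> best_approx r f p (cbox a b)
           \<le> ennreal C * total_modulus r f (b - a) p (cbox a b)))"
proof -
  have r: "1 \<le> r $ i" for i using assms by simp
  obtain C where C: "0 \<le> C" "Whitney_const r UNIV C"
    using Whitney_coordinates[of r UNIV] r by auto
  show ?thesis
  proof (intro exI[of _ "C + 1"] conjI allI impI ballI)
    show "0 < C + 1" using C by simp
    fix p and a b :: "real ^ 'd" and f
    assume p: "1 \<le> p" and ab: "\<forall>i. a $ i < b $ i" and f: "f \<in> Lp_space p (cbox a b)"
    let ?Q = "cbox a b"
    let ?T = "total_modulus r f (b - a) p ?Q"
    show "inverse (\<Sum>e\<in>(UNIV :: 'd set set). \<Prod>i\<in>e. 2 ^ (r $ i)) * ?T \<le> best_approx r f p ?Q"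
      by (rule total_modulus_le_best_approx[OF r p f])
    show "best_approx r f p ?Q \<le> ennreal (C + 1) * ?T"
    proof (cases ?T)
      case (real W)
      obtain g B0 where g[measurable]: "g \<in> borel_measurable borel" and ae: "AE x in lborel. x \<in> ?Q \<longrightarrow> f x = g x"
        and gB: "Lp_le p (\<lambda>x. indicator ?Q x * g x) B0" using Lp_space_Borel_version[OF p f] .
      have dir: "Lp_le p (dir_diff l a b (r $ l) \<eta> g) W" if \<eta>: "\<bar>\<eta>\<bar> \<le> b $ l - a $ l" for l \<eta>
      proof -
        define h :: "real ^ 'd" where "h = \<eta> *\<^sub>R axis l 1"
        let ?\<rho> = "restrict_index r {l}"
        let ?D = "shift_domain ?Q (\<chi> i. real (?\<rho> $ i) * h $ i)"
        have h: "\<forall>i. \<bar>h $ i\<bar> \<le> (b - a) $ i" using \<eta> ab by (auto simp: h_def axis_def less_imp_le)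
        have "Lp_norm p ?D (mixed_diff ?\<rho> h f) \<le> mixed_modulus ?\<rho> f (b - a) p ?Q"
          unfolding mixed_modulus_def by (rule SUP_upper) (use h in simp)
        also have "\<dots> \<le> ?T" unfolding total_modulus_def
          by (rule member_le_sum[where f = "\<lambda>e. mixed_modulus (restrict_index r e) f (b - a) p ?Q"]) auto
        finally have "Lp_le p (\<lambda>x. indicator ?D x * mixed_diff ?\<rho> h g x) W"
          using Lp_norm_le_iff[OF p sets_shift_domain mixed_diff_AE_bound(1,2)[OF p g ae gB] real(1)] real(2) by simp
        moreover have "(\<chi> i. real (?\<rho> $ i) * h $ i) = (real (r $ l) * \<eta>) *\<^sub>R axis l 1"
          by (auto simp: vec_eq_iff h_def axis_def restrict_index_def)
        moreover have "mixed_diff ?\<rho> h g = partial_fdiff l (r $ l) \<eta> g"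
          unfolding mixed_diff_single by (simp add: h_def axis_def)
        ultimately show ?thesis
          by (simp add: dir_diff_def[abs_def] shift_domain_def indicator_def of_bool_conj)
      qed
      obtain \<phi> where \<phi>: "coord_poly a b r UNIV \<phi>" "Lp_le p (\<lambda>x. indicator ?Q x * (g x - \<phi> x)) (C * W)"
        by (rule Whitney_constD[OF C(2) p ab g gB dir])
      have \<phi>P: "\<phi> \<in> poly_space r" by (rule coord_poly_UNIV[OF \<phi>(1)])
      have [measurable]: "\<phi> \<in> borel_measurable borel" by (rule poly_space_measurable[OF \<phi>P])
      have "best_approx r f p ?Q \<le> Lp_norm p ?Q (\<lambda>x. f x - \<phi> x)"
        unfolding best_approx_def by (rule INF_lower[OF \<phi>P])
      also have "\<dots> \<le> ennreal (C * W)"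
      proof -
        have "AE x in lborel. x \<in> ?Q \<longrightarrow> f x - \<phi> x = g x - \<phi> x" using ae by eventually_elim simp
        from Lp_norm_le_iff[OF p _ _ this Lp_le_nonneg[OF \<phi>(2)]] show ?thesis using \<phi>(2) by simp
      qed
      also have "\<dots> \<le> ennreal ((C + 1) * W)" using real(1) by (intro ennreal_leI mult_right_mono) auto
      also have "\<dots> = ennreal (C + 1) * ?T" using real C(1) by (simp add: ennreal_mult)
      finally show ?thesis .
    next
      case top
      then show ?thesis using C(1) by (simp add: ennreal_mult_top)
    qed
  qed
qed

end
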